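(* Let $(E,\mathcal L,\mathcal B)$ be a set-finite, receiver set-finite, weakly left-resolving labelled space such that $E$ has no sinks and $\mathcal B$ is closed under relative complements. Let $(E,\mathcal L,[\mathcal B]_R)$ be a weakly left-resolving quotient labelled space of $(E,\mathcal L,\mathcal B)$ and let $C^*(E,\mathcal L,[\mathcal B]_R)=C^*(s_a,p_{[A]})$, with gauge action $\gamma$. Let $\{S_a,P_{[A]}\}$ be a representation of $(E,\mathcal L,[\mathcal B]_R)$ such that $P_{[A]}\neq0$ whenever $[A]\ne[\emptyset]$ and $S_a\neq0$ whenever $[r(a)]\neq[\emptyset]$. Let $\pi_{S,P}:C^*(E,\mathcal L,[\mathcal B]_R)\to C^*(S_a,P_{[A]})$ be the homomorphism satisfying $\pi_{S,P}(s_a)=S_a$ and $\pi_{S,P}(p_{[A]})=P_{[A]}$. If there is a strongly continuous action $\beta$ of $\mathbb T$ on $C^*(S_a,P_{[A]})$ such that $\beta_z\circ\pi_{S,P}=\pi_{S,P}\circ\gamma_z$ for all $z\in\mathbb T$, then $\pi_{S,P}$ is faithful.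
   Context: Labelled spaces. A directed graph $E=(E^0,E^1,r,s)$ has countable sets $E^0$ (vertices), $E^1$ (edges) and range, source maps $r,s:E^1\to E^0$; $E$ has no sinks if every vertex emits an edge. $E^n$ is the set of paths $\lambda=\lambda_1\cdots\lambda_n$ ($r(\lambda_i)=s(\lambda_{i+1})$), $E^{\ge1}=\bigcup_{n\ge1}E^n$, and $r,s$ extend to paths. A labelled graph $(E,\mathcal L)$ over a countable alphabet $\mathcal A$ has a surjective labelling map $\mathcal L:E^1\to\mathcal A$, extended to paths by concatenation; $\mathcal L^*(E)=\mathcal L(E^{\ge1})$. For $\alpha\in\mathcal L^*(E)$ and $A\subset E^0$, $r(\alpha)=\{r(\lambda):\mathcal L(\lambda)=\alpha\}$ and $r(A,\alpha)=\{r(\lambda):\mathcal L(\lambda)=\alpha,\ s(\lambda)\in A\}$. A collection $\mathcal B\subset 2^{E^0}$ is accommodating if it contains $r(\alpha)$ for all $\alpha\in\mathcal L^*(E)$ and is closed under $A\mapsto r(A,\alpha)$, finite unions and finite intersections; then $(E,\mathcal L,\mathcal B)$ is a labelled space. It is weakly left-resolving if $r(A,\alpha)\cap r(B,\alpha)=r(A\cap B,\alpha)$ for all $A,B\in\mathcal B$, $\alpha\in\mathcal L^*(E)$. With $AE^1=\{e\in E^1:s(e)\in A\}$, $E^1A=\{e\in E^1:r(e)\in A\}$, it is set-finite (receiver set-finite) if $\mathcal L(AE^1)$ ($\mathcal L(E^1A)$) is finite for all $A\in\mathcal B$. $\mathcal B$ is closed under relative complements if $A\setminus B\in\mathcal B$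 for all $A,B\in\mathcal B$. Quotient labelled spaces. Let $\sim_R$ be an equivalence relation on $\mathcal B$, $[A]$ the class of $A$, $[\mathcal B]_R=\{[A]:A\in\mathcal B\}$, and $\mathcal A_R=\{a\in\mathcal A:[r(a)]\ne[\emptyset]\}$; $(\mathcal A_R)^*$ is the set of finite words of length $\ge1$ over $\mathcal A_R$. $(E,\mathcal L,[\mathcal B]_R)$ is a quotient labelled space of $(E,\mathcal L,\mathcal B)$ if $[A]\cup[B]:=[A\cup B]$, $[A]\cap[B]:=[A\cap B]$, $[A]\setminus[B]:=[A\setminus B]$ are well-defined on $[\mathcal B]_R$, the relative range $r([A],\alpha):=[r(A,\alpha)]$ is well-defined for $[A]\in[\mathcal B]_R$, $\alpha\in\mathcal L^*(E)\cap(\mathcal A_R)^*$, and $r([A],\alpha)=[\emptyset]$ for all $\alpha\in\mathcal L^*(E)\cap(\mathcal A_R)^*$ implies $[A]=[\emptyset]$. It is weakly left-resolving if $r([A],\alpha)\cap r([B],\alpha)=r([A]\cap[B],\alpha)$ for all $[A],[B]\in[\mathcal B]_R$, $\alpha\in\mathcal L^*(E)\cap(\mathcal A_R)^*$. A representation of a weakly left-resolving quotient labelled space consists of projections $\{p_{[A]}:[A]\in[\mathcal B]_R\}$ and partial isometries $\{s_a:a\in\mathcal A_R\}$ with: (1) $p_{[\emptyset]}=0$, $p_{[A]}p_{[B]}=p_{[A]\cap[B]}$, $p_{[A]\cup[B]}=p_{[A]}+p_{[B]}-p_{[A]\cap[B]}$; (2) $p_{[A]}s_a=s_ap_{r([A],a)}$;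 (3) $s_a^*s_a=p_{[r(a)]}$, $s_a^*s_b=0$ unless $a=b$; (4) if $\mathcal L([A]E^1)\cap\mathcal A_R\ne\emptyset$, then $p_{[A]}=\sum_{a\in\mathcal L([A]E^1)\cap\mathcal A_R}s_ap_{r([A],a)}s_a^*$, where $\mathcal L([A]E^1)=\bigcup_{A'\sim_RA}\mathcal L(A'E^1)$ (only finitely many terms have $r([A],a)\neq[\emptyset]$, the others being zero). $C^*(E,\mathcal L,[\mathcal B]_R)=C^*(s_a,p_{[A]})$ denotes the $C^*$-algebra generated by a universal representation; its gauge action $\gamma$ of $\mathbb T$ is given by $\gamma_z(s_a)=zs_a$, $\gamma_z(p_{[A]})=p_{[A]}$. $C^*(S_a,P_{[A]})$ is the $C^*$-algebra generated by the given representation. *)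

theory Defs
  imports "HOL-Analysis.Analysis" "Graph_Theory.Arc_Walk"
begin

section \<open>C*-algebras\<close>

text \<open>Not necessarily unital.\<close>

class cstar_algebra = real_normed_algebra + banach +
  fixes scaleC :: "complex \<Rightarrow> 'a \<Rightarrow> 'a"  (infixr "*\<^sub>C" 75)
    and adj :: "'a \<Rightarrow> 'a"
  assumes scaleC_add_right: "c *\<^sub>C (x + y) = c *\<^sub>C x + c *\<^sub>C y"
    and scaleC_add_left: "(c + d) *\<^sub>C x = c *\<^sub>C x + d *\<^sub>C x"
    and scaleC_scaleC: "c *\<^sub>C d *\<^sub>C x = (c * d) *\<^sub>C x"
    and scaleR_scaleC: "r *\<^sub>R x = complex_of_real r *\<^sub>C x"
    and mult_scaleC_left: "(c *\<^sub>C x) * y = c *\<^sub>C (x * y)"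
    and mult_scaleC_right: "x * (c *\<^sub>C y) = c *\<^sub>C (x * y)"
    and norm_scaleC: "norm (c *\<^sub>C x) = cmod c * norm x"
    and adj_add: "adj (x + y) = adj x + adj y"
    and adj_scaleC: "adj (c *\<^sub>C x) = cnj c *\<^sub>C adj x"
    and adj_mult: "adj (x * y) = adj y * adj x"
    and adj_adj: "adj (adj x) = x"
    and cstar_identity: "norm (adj x * x) = (norm x)\<^sup>2"

definition closed_star_subalgebra :: "'a::cstar_algebra set \<Rightarrow> bool" where
  "closed_star_subalgebra Y \<longleftrightarrow>
     closed Y \<and> 0 \<in> Y \<and>
     (\<forall>x\<in>Y. \<forall>y\<in>Y. x + y \<in> Y \<and> x * y \<in> Y) \<and>
     (\<forall>x\<in>Y. adj x \<in> Y \<and> (\<forall>c. c *\<^sub>C x \<in> Y))"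

definition cstar_generated :: "'a::cstar_algebra set \<Rightarrow> 'a set" where
  "cstar_generated X = \<Inter>{Y. closed_star_subalgebra Y \<and> X \<subseteq> Y}"

text \<open>
  A universal property quantifies over all C*-algebras, which the type class cannot do
  inside a formula. For that purpose there is a second presentation with an explicit
  carrier; \<open>alg_on Y\<close> is the C*-algebra that a closed star-subalgebra \<open>Y\<close> of a type of
  class \<open>cstar_algebra\<close> forms.
\<close>

record 'x alg =
  acarrier :: "'x set"
  azero :: 'x
  aadd :: "'x \<Rightarrow> 'x \<Rightarrow> 'x"
  amult :: "'x \<Rightarrow> 'x \<Rightarrow> 'x"
  ascale :: "complex \<Rightarrow> 'x \<Rightarrow> 'x"
  aadj :: "'x \<Rightarrow> 'x"
  anorm :: "'x \<Rightarrow> real"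

definition alg_on :: "'a::cstar_algebra set \<Rightarrow> 'a alg" where
  "alg_on Y = \<lparr>acarrier = Y, azero = 0, aadd = (+), amult = (*), ascale = (*\<^sub>C),
               aadj = adj, anorm = norm\<rparr>"

locale carrier_cstar_algebra =
  fixes D :: "'x alg"
  assumes zero_closed: "azero D \<in> acarrier D"
    and add_closed: "\<lbrakk>x \<in> acarrier D; y \<in> acarrier D\<rbrakk> \<Longrightarrow> aadd D x y \<in> acarrier D"
    and mult_closed: "\<lbrakk>x \<in> acarrier D; y \<in> acarrier D\<rbrakk> \<Longrightarrow> amult D x y \<in> acarrier D"
    and scale_closed: "x \<in> acarrier D \<Longrightarrow> ascale D c x \<in> acarrier D"
    and adj_closed: "x \<in> acarrier D \<Longrightarrow> aadj D x \<in> acarrier D"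
    and add_assoc: "\<lbrakk>x \<in> acarrier D; y \<in> acarrier D; z \<in> acarrier D\<rbrakk> \<Longrightarrow>
      aadd D (aadd D x y) z = aadd D x (aadd D y z)"
    and add_commute: "\<lbrakk>x \<in> acarrier D; y \<in> acarrier D\<rbrakk> \<Longrightarrow> aadd D x y = aadd D y x"
    and add_zero: "x \<in> acarrier D \<Longrightarrow> aadd D (azero D) x = x"
    and add_inverse: "x \<in> acarrier D \<Longrightarrow> aadd D x (ascale D (-1) x) = azero D"
    and scale_add_right: "\<lbrakk>x \<in> acarrier D; y \<in> acarrier D\<rbrakk> \<Longrightarrow>
      ascale D c (aadd D x y) = aadd D (ascale D c x) (ascale D c y)"
    and scale_add_left: "x \<in> acarrier D \<Longrightarrow>
      ascale D (c + d) x = aadd D (ascale D c x) (ascale D d x)"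
    and scale_scale: "x \<in> acarrier D \<Longrightarrow> ascale D c (ascale D d x) = ascale D (c * d) x"
    and scale_one: "x \<in> acarrier D \<Longrightarrow> ascale D 1 x = x"
    and mult_assoc: "\<lbrakk>x \<in> acarrier D; y \<in> acarrier D; z \<in> acarrier D\<rbrakk> \<Longrightarrow>
      amult D (amult D x y) z = amult D x (amult D y z)"
    and distrib_right: "\<lbrakk>x \<in> acarrier D; y \<in> acarrier D; z \<in> acarrier D\<rbrakk> \<Longrightarrow>
      amult D (aadd D x y) z = aadd D (amult D x z) (amult D y z)"
    and distrib_left: "\<lbrakk>x \<in> acarrier D; y \<in> acarrier D; z \<in> acarrier D\<rbrakk> \<Longrightarrow>
      amult D x (aadd D y z) = aadd D (amult D x y) (amult D x z)"
    and mult_scale_left: "\<lbrakk>x \<in> acarrier D; y \<in> acarrier D\<rbrakk> \<Longrightarrow>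
      amult D (ascale D c x) y = ascale D c (amult D x y)"
    and mult_scale_right: "\<lbrakk>x \<in> acarrier D; y \<in> acarrier D\<rbrakk> \<Longrightarrow>
      amult D x (ascale D c y) = ascale D c (amult D x y)"
    and adj_add: "\<lbrakk>x \<in> acarrier D; y \<in> acarrier D\<rbrakk> \<Longrightarrow>
      aadj D (aadd D x y) = aadd D (aadj D x) (aadj D y)"
    and adj_scale: "x \<in> acarrier D \<Longrightarrow> aadj D (ascale D c x) = ascale D (cnj c) (aadj D x)"
    and adj_mult: "\<lbrakk>x \<in> acarrier D; y \<in> acarrier D\<rbrakk> \<Longrightarrow>
      aadj D (amult D x y) = amult D (aadj D y) (aadj D x)"
    and adj_adj: "x \<in> acarrier D \<Longrightarrow> aadj D (aadj D x) = x"
    and norm_nonneg: "x \<in> acarrier D \<Longrightarrow> anorm D x \<ge> 0"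
    and norm_eq_zero: "x \<in> acarrier D \<Longrightarrow> anorm D x = 0 \<longleftrightarrow> x = azero D"
    and norm_triangle: "\<lbrakk>x \<in> acarrier D; y \<in> acarrier D\<rbrakk> \<Longrightarrow>
      anorm D (aadd D x y) \<le> anorm D x + anorm D y"
    and norm_scale: "x \<in> acarrier D \<Longrightarrow> anorm D (ascale D c x) = cmod c * anorm D x"
    and norm_mult: "\<lbrakk>x \<in> acarrier D; y \<in> acarrier D\<rbrakk> \<Longrightarrow>
      anorm D (amult D x y) \<le> anorm D x * anorm D y"
    and cstar_identity: "x \<in> acarrier D \<Longrightarrow> anorm D (amult D (aadj D x) x) = (anorm D x)\<^sup>2"
    and complete:
      "\<lbrakk>\<And>n. f n \<in> acarrier D;
        \<And>e. e > 0 \<Longrightarrow> \<exists>N. \<forall>m\<ge>N. \<forall>n\<ge>N. anorm D (aadd D (f m) (ascale D (-1) (f n))) < e\<rbrakk>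
       \<Longrightarrow> \<exists>x\<in>acarrier D. (\<lambda>n. anorm D (aadd D (f n) (ascale D (-1) x))) \<longlonglongrightarrow> 0"

lemma carrier_cstar_algebra_alg_on:
  assumes "closed_star_subalgebra Y"
  shows "carrier_cstar_algebra (alg_on Y)"
proof -
  have m: "(-1) *\<^sub>C x = - x" for x :: "'a::cstar_algebra"
    using scaleR_scaleC[of "-1" x] by simp
  have o: "1 *\<^sub>C x = x" for x :: "'a::cstar_algebra"
    using scaleR_scaleC[of 1 x] by simp
  have cl: "closed Y" using assms by (simp add: closed_star_subalgebra_def)
  show ?thesis
  proof (unfold_locales, goal_cases)
    case (29 f)
    then have f: "\<And>n. f n \<in> Y" and c: "\<And>e. e > 0 \<Longrightarrow> \<exists>N. \<forall>m\<ge>N. \<forall>n\<ge>N. norm (f m - f n) < e"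
      by (simp_all add: alg_on_def m)
    have "Cauchy f" using c by (auto simp: Cauchy_def dist_norm)
    then obtain x where x: "f \<longlonglongrightarrow> x" using Cauchy_convergent_iff convergent_def by blast
    then have "x \<in> Y" using closed_sequentially[OF cl] f by blast
    moreover have "(\<lambda>n. norm (f n - x)) \<longlonglongrightarrow> 0"
      using x by (simp add: LIM_zero_iff tendsto_norm_zero)
    ultimately show ?case by (auto simp: alg_on_def m)
  qed (use assms in \<open>auto simp: closed_star_subalgebra_def alg_on_def m o algebra_simps scaleC_add_left
         scaleC_add_right scaleC_scaleC mult_scaleC_left mult_scaleC_right norm_scaleC adj_add
         adj_scaleC adj_mult adj_adj cstar_identity norm_triangle_ineq norm_mult_ineq\<close>)
qed

definition star_hom :: "'x alg \<Rightarrow> 'y alg \<Rightarrow> ('x \<Rightarrow> 'y) \<Rightarrow> bool" where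
  "star_hom C D \<phi> \<longleftrightarrow>
     (\<forall>x\<in>acarrier C. \<phi> x \<in> acarrier D) \<and>
     (\<forall>x\<in>acarrier C. \<forall>y\<in>acarrier C. \<phi> (aadd C x y) = aadd D (\<phi> x) (\<phi> y)) \<and>
     (\<forall>x\<in>acarrier C. \<forall>y\<in>acarrier C. \<phi> (amult C x y) = amult D (\<phi> x) (\<phi> y)) \<and>
     (\<forall>x\<in>acarrier C. \<forall>c. \<phi> (ascale C c x) = ascale D c (\<phi> x)) \<and>
     (\<forall>x\<in>acarrier C. \<phi> (aadj C x) = aadj D (\<phi> x))"

definition alg_projection :: "'x alg \<Rightarrow> 'x \<Rightarrow> bool" where
  "alg_projection D x \<longleftrightarrow> x \<in> acarrier D \<and> amult D x x = x \<and> aadj D x = x"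

definition alg_partial_isometry :: "'x alg \<Rightarrow> 'x \<Rightarrow> bool" where
  "alg_partial_isometry D x \<longleftrightarrow>
     x \<in> acarrier D \<and> amult D (amult D x (aadj D x)) x = x"

definition alg_sum :: "'x alg \<Rightarrow> ('i \<Rightarrow> 'x) \<Rightarrow> 'i set \<Rightarrow> 'x" where
  "alg_sum D f F = Finite_Set.fold (\<lambda>i. aadd D (f i)) (azero D) F"

lemma alg_sum_alg_on: "alg_sum (alg_on Y) f F = sum f F"
  by (simp add: alg_sum_def alg_on_def sum.eq_fold comp_def)

text \<open>
  Actions of the circle group on a C*-algebra \<open>Y\<close> by star-automorphisms
  (each \<open>\<beta> z\<close> is invertible with inverse \<open>\<beta> (inverse z)\<close>).
\<close>

definition circle_action :: "'a::cstar_algebra set \<Rightarrow> (complex \<Rightarrow> 'a \<Rightarrow> 'a) \<Rightarrow> bool" where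
  "circle_action Y \<beta> \<longleftrightarrow>
     (\<forall>z\<in>sphere 0 1. star_hom (alg_on Y) (alg_on Y) (\<beta> z)) \<and>
     (\<forall>x\<in>Y. \<beta> 1 x = x) \<and>
     (\<forall>z\<in>sphere 0 1. \<forall>w\<in>sphere 0 1. \<forall>x\<in>Y. \<beta> (z * w) x = \<beta> z (\<beta> w x))"

definition strongly_continuous_on :: "'a::cstar_algebra set \<Rightarrow> (complex \<Rightarrow> 'a \<Rightarrow> 'a) \<Rightarrow> bool" where
  "strongly_continuous_on Y \<beta> \<longleftrightarrow> (\<forall>x\<in>Y. continuous_on (sphere 0 1) (\<lambda>z. \<beta> z x))"


section \<open>Labelled spaces\<close>

text \<open>
  For a directed graph \<open>E\<close>, the vertices are \<open>verts E\<close>, the edges \<open>arcs E\<close>, the source map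
  \<open>tail E\<close> and the range map \<open>head E\<close>; \<open>pre_digraph.awalk E u \<mu> v\<close> says that the edge
  list \<open>\<mu>\<close> is a path with source \<open>u\<close> and range \<open>v\<close>. Paths of length 0 are excluded below.
\<close>

locale labelled_graph = wf_digraph E
  for E :: "('v, 'e) pre_digraph" +
  fixes lab :: "'e \<Rightarrow> 'l" and \<A> :: "'l set"
  assumes countable_verts: "countable (verts E)"
    and countable_arcs: "countable (arcs E)"
    and countable_alphabet: "countable \<A>"
    and lab_surj: "lab ` arcs E = \<A>"

definition no_sinks :: "('v, 'e) pre_digraph \<Rightarrow> bool" where
  "no_sinks E \<longleftrightarrow> (\<forall>v\<in>verts E. out_arcs E v \<noteq> {})"

definition labelled_words :: "('v, 'e) pre_digraph \<Rightarrow> ('e \<Rightarrow> 'l) \<Rightarrow> 'l list set" where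
  "labelled_words E lab = {map lab \<mu> |\<mu> u v. \<mu> \<noteq> [] \<and> pre_digraph.awalk E u \<mu> v}"

definition word_range :: "('v, 'e) pre_digraph \<Rightarrow> ('e \<Rightarrow> 'l) \<Rightarrow> 'l list \<Rightarrow> 'v set" where
  "word_range E lab \<alpha> =
     {v. \<exists>u \<mu>. \<mu> \<noteq> [] \<and> pre_digraph.awalk E u \<mu> v \<and> map lab \<mu> = \<alpha>}"

definition rel_range :: "('v, 'e) pre_digraph \<Rightarrow> ('e \<Rightarrow> 'l) \<Rightarrow> 'v set \<Rightarrow> 'l list \<Rightarrow> 'v set" where
  "rel_range E lab A \<alpha> =
     {v. \<exists>u\<in>A. \<exists>\<mu>. \<mu> \<noteq> [] \<and> pre_digraph.awalk E u \<mu> v \<and> map lab \<mu> = \<alpha>}"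

definition out_labels :: "('v, 'e) pre_digraph \<Rightarrow> ('e \<Rightarrow> 'l) \<Rightarrow> 'v set \<Rightarrow> 'l set" where
  "out_labels E lab A = lab ` {e \<in> arcs E. tail E e \<in> A}"

definition in_labels :: "('v, 'e) pre_digraph \<Rightarrow> ('e \<Rightarrow> 'l) \<Rightarrow> 'v set \<Rightarrow> 'l set" where
  "in_labels E lab A = lab ` {e \<in> arcs E. head E e \<in> A}"

locale labelled_space = labelled_graph E lab \<A>
  for E :: "('v, 'e) pre_digraph" and lab :: "'e \<Rightarrow> 'l" and \<A> :: "'l set" +
  fixes \<B> :: "'v set set"
  assumes sets_verts: "\<B> \<subseteq> Pow (verts E)"
    and word_range_mem: "\<alpha> \<in> labelled_words E lab \<Longrightarrow> word_range E lab \<alpha> \<in> \<B>"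
    and rel_range_mem: "\<lbrakk>A \<in> \<B>; \<alpha> \<in> labelled_words E lab\<rbrakk> \<Longrightarrow> rel_range E lab A \<alpha> \<in> \<B>"
    and union_mem: "\<lbrakk>A \<in> \<B>; B \<in> \<B>\<rbrakk> \<Longrightarrow> A \<union> B \<in> \<B>"
    and inter_mem: "\<lbrakk>A \<in> \<B>; B \<in> \<B>\<rbrakk> \<Longrightarrow> A \<inter> B \<in> \<B>"

definition weakly_left_resolving ::
    "('v, 'e) pre_digraph \<Rightarrow> ('e \<Rightarrow> 'l) \<Rightarrow> 'v set set \<Rightarrow> bool" where
  "weakly_left_resolving E lab \<B> \<longleftrightarrow>
     (\<forall>A\<in>\<B>. \<forall>B\<in>\<B>. \<forall>\<alpha>\<in>labelled_words E lab.
        rel_range E lab A \<alpha> \<inter> rel_range E lab B \<alpha> = rel_range E lab (A \<inter> B) \<alpha>)"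

definition set_finite :: "('v, 'e) pre_digraph \<Rightarrow> ('e \<Rightarrow> 'l) \<Rightarrow> 'v set set \<Rightarrow> bool" where
  "set_finite E lab \<B> \<longleftrightarrow> (\<forall>A\<in>\<B>. finite (out_labels E lab A))"

definition receiver_set_finite :: "('v, 'e) pre_digraph \<Rightarrow> ('e \<Rightarrow> 'l) \<Rightarrow> 'v set set \<Rightarrow> bool" where
  "receiver_set_finite E lab \<B> \<longleftrightarrow> (\<forall>A\<in>\<B>. finite (in_labels E lab A))"

definition closed_under_rel_complements :: "'v set set \<Rightarrow> bool" where
  "closed_under_rel_complements \<B> \<longleftrightarrow> (\<forall>A\<in>\<B>. \<forall>B\<in>\<B>. A - B \<in> \<B>)"


section \<open>Quotient labelled spaces and their representations\<close>

text \<open>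
  The class of \<open>A\<close> is \<open>R `` {A}\<close> and the set of classes is \<open>\<B> // R\<close>. The operations on
  classes are given by representatives, so that the relative range of the class of \<open>A\<close>
  is written \<open>R `` {rel_range E lab A \<alpha>}\<close>, and similarly for the Boolean operations.
\<close>

definition quot_alphabet ::
    "('v, 'e) pre_digraph \<Rightarrow> ('e \<Rightarrow> 'l) \<Rightarrow> 'l set \<Rightarrow> ('v set \<times> 'v set) set \<Rightarrow> 'l set" where
  "quot_alphabet E lab \<A> R = {a \<in> \<A>. R `` {word_range E lab [a]} \<noteq> R `` {{}}}"

definition quot_words ::
    "('v, 'e) pre_digraph \<Rightarrow> ('e \<Rightarrow> 'l) \<Rightarrow> 'l set \<Rightarrow> ('v set \<times> 'v set) set \<Rightarrow> 'l list set" where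
  "quot_words E lab \<A> R = labelled_words E lab \<inter> lists (quot_alphabet E lab \<A> R)"

definition quotient_labelled_space ::
    "('v, 'e) pre_digraph \<Rightarrow> ('e \<Rightarrow> 'l) \<Rightarrow> 'l set \<Rightarrow> 'v set set \<Rightarrow> ('v set \<times> 'v set) set \<Rightarrow> bool" where
  "quotient_labelled_space E lab \<A> \<B> R \<longleftrightarrow>
     equiv \<B> R \<and>
     (\<lambda>A B. R `` {A \<union> B}) respects2 R \<and>
     (\<lambda>A B. R `` {A \<inter> B}) respects2 R \<and>
     (\<lambda>A B. R `` {A - B}) respects2 R \<and>
     (\<forall>\<alpha>\<in>quot_words E lab \<A> R. (\<lambda>A. R `` {rel_range E lab A \<alpha>}) respects R) \<and>
     (\<forall>A\<in>\<B>. (\<forall>\<alpha>\<in>quot_words E lab \<A> R. R `` {rel_range E lab A \<alpha>} = R `` {{}})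
              \<longrightarrow> R `` {A} = R `` {{}})"

definition quot_weakly_left_resolving ::
    "('v, 'e) pre_digraph \<Rightarrow> ('e \<Rightarrow> 'l) \<Rightarrow> 'l set \<Rightarrow> 'v set set \<Rightarrow> ('v set \<times> 'v set) set \<Rightarrow> bool" where
  "quot_weakly_left_resolving E lab \<A> \<B> R \<longleftrightarrow>
     (\<forall>A\<in>\<B>. \<forall>B\<in>\<B>. \<forall>\<alpha>\<in>quot_words E lab \<A> R.
        R `` {rel_range E lab A \<alpha> \<inter> rel_range E lab B \<alpha>} = R `` {rel_range E lab (A \<inter> B) \<alpha>})"

definition quot_out_labels ::
    "('v, 'e) pre_digraph \<Rightarrow> ('e \<Rightarrow> 'l) \<Rightarrow> ('v set \<times> 'v set) set \<Rightarrow> 'v set \<Rightarrow> 'l set" where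
  "quot_out_labels E lab R A = (\<Union>A'\<in>R `` {A}. out_labels E lab A')"

text \<open>
  In the last relation only the labels with non-trivial relative range are summed over.
  The remaining terms are zero because of \<open>p (R `` {{}}) = 0\<close>, whereas the index set
  including them may be infinite. For a set-finite labelled space, \<open>F\<close> is finite: it is
  contained in \<open>out_labels E lab A\<close>.
\<close>

definition quot_representation ::
    "('v, 'e) pre_digraph \<Rightarrow> ('e \<Rightarrow> 'l) \<Rightarrow> 'l set \<Rightarrow> 'v set set \<Rightarrow> ('v set \<times> 'v set) set \<Rightarrow>
     'x alg \<Rightarrow> ('l \<Rightarrow> 'x) \<Rightarrow> ('v set set \<Rightarrow> 'x) \<Rightarrow> bool" where
  "quot_representation E lab \<A> \<B> R D s p \<longleftrightarrow>
     (\<forall>X\<in>\<B> // R. alg_projection D (p X)) \<and>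
     (\<forall>a\<in>quot_alphabet E lab \<A> R. alg_partial_isometry D (s a)) \<and>
     p (R `` {{}}) = azero D \<and>
     (\<forall>A\<in>\<B>. \<forall>B\<in>\<B>. amult D (p (R `` {A})) (p (R `` {B})) = p (R `` {A \<inter> B})) \<and>
     (\<forall>A\<in>\<B>. \<forall>B\<in>\<B>. p (R `` {A \<union> B}) =
        aadd D (aadd D (p (R `` {A})) (p (R `` {B}))) (ascale D (-1) (p (R `` {A \<inter> B})))) \<and>
     (\<forall>A\<in>\<B>. \<forall>a\<in>quot_alphabet E lab \<A> R.
        amult D (p (R `` {A})) (s a) = amult D (s a) (p (R `` {rel_range E lab A [a]}))) \<and>
     (\<forall>a\<in>quot_alphabet E lab \<A> R. amult D (aadj D (s a)) (s a) = p (R `` {word_range E lab [a]})) \<and>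
     (\<forall>a\<in>quot_alphabet E lab \<A> R. \<forall>b\<in>quot_alphabet E lab \<A> R.
        a \<noteq> b \<longrightarrow> amult D (aadj D (s a)) (s b) = azero D) \<and>
     (\<forall>A\<in>\<B>. quot_out_labels E lab R A \<inter> quot_alphabet E lab \<A> R \<noteq> {} \<longrightarrow>
        (let F = {a \<in> quot_out_labels E lab R A \<inter> quot_alphabet E lab \<A> R.
                    R `` {rel_range E lab A [a]} \<noteq> R `` {{}}}
         in p (R `` {A}) =
              alg_sum D (\<lambda>a. amult D (amult D (s a) (p (R `` {rel_range E lab A [a]}))) (aadj D (s a))) F))"

definition rep_cstar ::
    "('v, 'e) pre_digraph \<Rightarrow> ('e \<Rightarrow> 'l) \<Rightarrow> 'l set \<Rightarrow> 'v set set \<Rightarrow> ('v set \<times> 'v set) set \<Rightarrow>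
     ('l \<Rightarrow> 'a::cstar_algebra) \<Rightarrow> ('v set set \<Rightarrow> 'a) \<Rightarrow> 'a set" where
  "rep_cstar E lab \<A> \<B> R s p = cstar_generated (s ` quot_alphabet E lab \<A> R \<union> p ` (\<B> // R))"

text \<open>
  Letting \<open>D\<close> range over the C*-algebras whose carrier consists of real numbers loses no
  generality. Since \<open>\<A>\<close> and \<open>verts E\<close> are countable, there are at most
  continuum many generators. Hence the C*-algebra generated by any representation has
  at most the cardinality of the continuum, and is isomorphic to such a \<open>D\<close>.
\<close>

definition universal_representation ::
    "('v, 'e) pre_digraph \<Rightarrow> ('e \<Rightarrow> 'l) \<Rightarrow> 'l set \<Rightarrow> 'v set set \<Rightarrow> ('v set \<times> 'v set) set \<Rightarrow>
     ('l \<Rightarrow> 'a::cstar_algebra) \<Rightarrow> ('v set set \<Rightarrow> 'a) \<Rightarrow> bool" where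
  "universal_representation E lab \<A> \<B> R s p \<longleftrightarrow>
     quot_representation E lab \<A> \<B> R (alg_on UNIV) s p \<and>
     (\<forall>(D :: real alg) T Q.
        carrier_cstar_algebra D \<and> quot_representation E lab \<A> \<B> R D T Q \<longrightarrow>
        (\<exists>\<phi>. star_hom (alg_on (rep_cstar E lab \<A> \<B> R s p)) D \<phi> \<and>
             (\<forall>a\<in>quot_alphabet E lab \<A> R. \<phi> (s a) = T a) \<and>
             (\<forall>X\<in>\<B> // R. \<phi> (p X) = Q X)))"

definition gauge_action ::
    "('v, 'e) pre_digraph \<Rightarrow> ('e \<Rightarrow> 'l) \<Rightarrow> 'l set \<Rightarrow> 'v set set \<Rightarrow> ('v set \<times> 'v set) set \<Rightarrow>
     ('l \<Rightarrow> 'a::cstar_algebra) \<Rightarrow> ('v set set \<Rightarrow> 'a) \<Rightarrow> (complex \<Rightarrow> 'a \<Rightarrow> 'a) \<Rightarrow> bool" where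
  "gauge_action E lab \<A> \<B> R s p \<gamma> \<longleftrightarrow>
     circle_action (rep_cstar E lab \<A> \<B> R s p) \<gamma> \<and>
     (\<forall>z\<in>sphere 0 1.
        (\<forall>a\<in>quot_alphabet E lab \<A> R. \<gamma> z (s a) = z *\<^sub>C s a) \<and>
        (\<forall>X\<in>\<B> // R. \<gamma> z (p X) = p X))"

end

theory Submission
  imports Defs
begin

text \<open>
  The homomorphism \<open>\<pi>\<close> is injective because it is isometric, and it is isometric because of a growth
  argument. A selfadjoint \<open>h\<close> satisfies \<open>\<parallel>h\<^sup>N\<parallel> = \<parallel>h\<parallel>\<^sup>N\<close> for every power \<open>N\<close> of 2, so a bound
  \<open>\<parallel>h\<^sup>N\<parallel> \<le> K N \<parallel>\<pi> h\<parallel>\<^sup>N\<close> for all these \<open>N\<close> already gives \<open>\<parallel>h\<parallel> \<le> \<parallel>\<pi> h\<parallel>\<close>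
  (\<open>selfadjoint_norm_le\<close>, \<open>selfadjoint_isometry\<close>). Crude triangle-inequality estimates, whose constants
  count terms, are therefore enough. This growth argument takes the place of spectral theory, of
  positivity and of the faithful conditional expectation onto the fixed-point algebra.

  The estimates are built up in three layers. On linear combinations of the projections
  \<open>p\<^bsub>[A]\<^esub>\<close> an induction splits along one projection at a time and reduces everything to
  \<open>P\<^bsub>[A]\<^esub> \<noteq> 0\<close> (\<open>norm_diagonal_le\<close>). On the core, the span of the \<open>s\<^sub>\<mu> p\<^bsub>[A]\<^esub> s\<^sub>\<nu>\<^sup>*\<close> with
  \<open>\<mu>\<close> and \<open>\<nu>\<close> of equal length, an element of level \<open>n + 1\<close> is a finite matrix with entries
  \<open>s\<^sub>a\<^sup>* x s\<^sub>b\<close> of level \<open>n\<close>, and the estimate follows by induction on the level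
  (\<open>norm_bihom_le\<close>). Finally, an element \<open>x\<close> of the dense star-algebra is a finite sum of homogeneous
  parts \<open>x\<^sub>j\<close> of degree \<open>j\<close> under the gauge action. Here \<open>x\<^sub>j\<^sup>* x\<^sub>j\<close> lies in the core, so
  \<open>\<parallel>x\<^sub>j\<parallel> = \<parallel>\<pi> x\<^sub>j\<parallel>\<close>, and averaging \<open>z\<^bsup>-j\<^esup> \<beta>\<^sub>z (\<pi> x)\<close> over sufficiently many roots of unity \<open>z\<close>
  gives \<open>\<parallel>\<pi> x\<^sub>j\<parallel> \<le> \<parallel>\<pi> x\<parallel>\<close>. Hence \<open>\<parallel>x\<parallel>\<close> is at most the number of degrees times \<open>\<parallel>\<pi> x\<parallel>\<close>. That number
  grows only linearly when \<open>x\<close> is replaced by its powers, so the growth argument applies again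
  (\<open>norm_laurent_le\<close>).

  Passing to the closure needs the continuity of star-homomorphisms. It comes from writing a
  selfadjoint contraction as the real part of a unitary (\<open>norm_hom_le\<close>).
\<close>

section \<open>Norm estimates in C*-algebras\<close>

lemma scaleC_one [simp]: "1 *\<^sub>C x = (x :: 'a::cstar_algebra)"
  using scaleR_scaleC[of 1 x] by simp

lemma scaleC_minus_one: "(-1) *\<^sub>C x = - (x :: 'a::cstar_algebra)"
  using scaleR_scaleC[of "-1" x] by simp

lemma scaleC_zero_left [simp]: "0 *\<^sub>C x = (0 :: 'a::cstar_algebra)"
  using scaleR_scaleC[of 0 x] by simp

lemma scaleC_zero_right [simp]: "c *\<^sub>C 0 = (0 :: 'a::cstar_algebra)"
  using scaleC_add_right[of c 0 "0 :: 'a"] by simp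

lemma scaleC_minus_right: "c *\<^sub>C (- x) = - (c *\<^sub>C x :: 'a::cstar_algebra)"
  using scaleC_add_right[of c x "- x"] by (simp add: eq_neg_iff_add_eq_0 add.commute)

lemma scaleC_minus_left: "(- c) *\<^sub>C x = - (c *\<^sub>C x :: 'a::cstar_algebra)"
  using scaleC_scaleC[of "-1" c x] by (simp add: scaleC_minus_one)

lemma scaleC_diff_right: "c *\<^sub>C (x - y) = c *\<^sub>C x - (c *\<^sub>C y :: 'a::cstar_algebra)"
  using scaleC_add_right[of c x "- y"] by (simp add: scaleC_minus_right)

lemma scaleC_sum_right: "c *\<^sub>C sum f I = (\<Sum>i\<in>I. c *\<^sub>C f i :: 'a::cstar_algebra)"
  by (induction I rule: infinite_finite_induct) (auto simp: scaleC_add_right)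

lemma scaleC_sum_left: "(\<Sum>i\<in>I. f i) *\<^sub>C x = (\<Sum>i\<in>I. f i *\<^sub>C x :: 'a::cstar_algebra)"
  by (induction I rule: infinite_finite_induct) (auto simp: scaleC_add_left)

lemma adj_zero [simp]: "adj 0 = (0 :: 'a::cstar_algebra)"
  using adj_add[of 0 "0 :: 'a"] by simp

lemma adj_minus: "adj (- x) = - adj (x :: 'a::cstar_algebra)"
  using adj_add[of x "- x"] by (simp add: eq_neg_iff_add_eq_0 add.commute)

lemma adj_diff: "adj (x - y) = adj x - adj (y :: 'a::cstar_algebra)"
  using adj_add[of x "- y"] by (simp add: adj_minus)

lemma adj_scaleR: "adj (r *\<^sub>R x) = r *\<^sub>R adj (x :: 'a::cstar_algebra)"
  by (simp add: scaleR_scaleC adj_scaleC)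

lemma adj_sum: "adj (sum f I) = (\<Sum>i\<in>I. adj (f i) :: 'a::cstar_algebra)"
  by (induction I rule: infinite_finite_induct) (auto simp: adj_add)

lemma norm_adj [simp]: "norm (adj x) = norm (x :: 'a::cstar_algebra)"
proof -
  have le: "norm y \<le> norm (adj y)" for y :: 'a
  proof (cases "y = 0")
    case False
    have "norm y * norm y \<le> norm (adj y) * norm y"
      using norm_mult_ineq[of "adj y" y] by (simp add: cstar_identity power2_eq_square)
    then show ?thesis using False by simp
  qed simp
  show ?thesis using le[of x] le[of "adj x"] by (simp add: adj_adj)
qed

lemma bounded_linear_adj: "bounded_linear (adj :: 'a::cstar_algebra \<Rightarrow> 'a)"
  by (rule bounded_linear_intro[where K=1]) (auto simp: adj_add adj_scaleR)

lemma bounded_linear_scaleC: "bounded_linear ((*\<^sub>C) c :: 'a::cstar_algebra \<Rightarrow> 'a)"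
  by (rule bounded_linear_intro[where K="cmod c"])
     (auto simp: scaleC_add_right norm_scaleC scaleR_scaleC scaleC_scaleC mult.commute)

lemmas continuous_on_adj [continuous_intros] = bounded_linear.continuous_on[OF bounded_linear_adj]

lemma norm_mult_contractions_le:
  fixes x y z :: "'a::real_normed_algebra"
  assumes "norm x \<le> 1" "norm z \<le> 1"
  shows "norm (x * y * z) \<le> norm y"
proof -
  have "norm (x * y * z) \<le> norm (x * y) * norm z" by (rule norm_mult_ineq)
  also have "\<dots> \<le> norm (x * y) * 1" using assms(2) by (intro mult_left_mono) auto
  also have "norm (x * y) \<le> norm x * norm y" by (rule norm_mult_ineq)
  also have "\<dots> \<le> 1 * norm y" using assms(1) by (intro mult_right_mono) auto
  finally show ?thesis by simp
qed

lemma norm_projection: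
  fixes e :: "'a::cstar_algebra"
  assumes "e * e = e" "adj e = e" "e \<noteq> 0"
  shows "norm e = 1"
  using cstar_identity[of e] assms by (simp add: power2_eq_square)

lemma norm_projection_le_1:
  fixes e :: "'a::cstar_algebra"
  assumes "e * e = e" "adj e = e"
  shows "norm e \<le> 1"
  using norm_projection[OF assms] by (cases "e = 0") auto

lemma norm_mult_projection_le:
  fixes x e :: "'a::cstar_algebra"
  assumes "e * e = e" "adj e = e"
  shows "norm (x * e) \<le> norm x"
  using norm_mult_ineq[of x e] mult_left_mono[OF norm_projection_le_1[OF assms], of "norm x"] by simp

lemma norm_le_1_if_adj_mult_le_1:
  fixes x :: "'a::cstar_algebra"
  assumes "norm (adj x * x) \<le> 1"
  shows "norm x \<le> 1"
  using assms by (simp add: cstar_identity power_le_one_iff abs_square_le_1)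

lemma norm_le_if_adj_mult_le:
  fixes x :: "'a::cstar_algebra" and y :: "'b::cstar_algebra"
  assumes "norm (adj x * x) \<le> norm (adj y * y)"
  shows "norm x \<le> norm y"
  using assms by (simp add: cstar_identity)

primrec iter_square :: "nat \<Rightarrow> 'a::times \<Rightarrow> 'a" where
  "iter_square 0 x = x"
| "iter_square (Suc n) x = iter_square n x * iter_square n x"

lemma adj_iter_square:
  "adj h = h \<Longrightarrow> adj (iter_square n h) = iter_square n (h :: 'a::cstar_algebra)"
  by (induction n) (auto simp: adj_mult)

lemma norm_iter_square:
  fixes h :: "'a::cstar_algebra"
  assumes "adj h = h"
  shows "norm (iter_square n h) = norm h ^ 2 ^ n"
proof (induction n)
  case (Suc n)
  show ?case
    using cstar_identity[of "iter_square n h"] Suc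
    by (simp add: adj_iter_square[OF assms] power_mult[symmetric] mult.commute)
qed simp

lemma norm_iter_square_le:
  fixes h :: "'a::real_normed_algebra"
  shows "norm (iter_square n h) \<le> norm h ^ 2 ^ n"
proof (induction n)
  case (Suc n)
  have "norm (iter_square (Suc n) h) \<le> norm (iter_square n h) * norm (iter_square n h)"
    by (simp add: norm_mult_ineq)
  also have "\<dots> \<le> norm h ^ 2 ^ n * norm h ^ 2 ^ n" by (intro mult_mono Suc) auto
  finally show ?case by (simp add: power_add[symmetric] mult_2)
qed simp

text \<open>
  If \<open>c < \<parallel>h\<parallel>\<close>, then \<open>(\<parallel>h\<parallel> / c)\<^sup>N\<close> with \<open>N = 2\<^sup>n\<close> would grow at most linearly in \<open>N\<close>.
\<close>

lemma selfadjoint_norm_le: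
  fixes h :: "'a::cstar_algebra"
  assumes "adj h = h" "c \<ge> 0"
    and bound: "\<And>n. norm (iter_square n h) \<le> K * 2 ^ n * c ^ 2 ^ n"
  shows "norm h \<le> c"
proof (rule ccontr)
  assume "\<not> norm h \<le> c"
  then have less: "c < norm h" by simp
  show False
  proof (cases "c = 0")
    case True
    have "norm h \<le> 0" using bound[of 0] True by simp
    then show False using less True by simp
  next
    case False
    define r where "r = norm h / c"
    have c: "c > 0" and r: "r > 1" using False assms(2) less by (auto simp: r_def)
    have "r ^ 2 ^ n \<le> K * 2 ^ n" for n
      using bound[of n] c
      by (simp add: norm_iter_square[OF assms(1)] r_def power_divide field_simps)
    moreover have "(\<lambda>n. real n / r ^ n) \<longlonglongrightarrow> 0"
      using r by (intro lim_n_over_pown) auto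
    then have "(\<lambda>n. real (2 ^ n) / r ^ 2 ^ n) \<longlonglongrightarrow> 0"
      by (rule filterlim_compose) (auto intro!: filterlim_subseq strict_monoI)
    then have "(\<lambda>n. K * (real (2 ^ n) / r ^ 2 ^ n)) \<longlonglongrightarrow> 0"
      by (rule tendsto_mult_right_zero)
    then have "eventually (\<lambda>n. K * (real (2 ^ n) / r ^ 2 ^ n) < 1) sequentially"
      by (rule order_tendstoD) simp
    then obtain n where "K * (real (2 ^ n) / r ^ 2 ^ n) < 1"
      by (auto simp: eventually_sequentially)
    then have "K * 2 ^ n < r ^ 2 ^ n" using r by (simp add: field_simps)
    ultimately show False by (meson not_le)
  qed
qed

lemma iter_square_sum_commute:
  fixes u v :: "'a::cstar_algebra"
  assumes "u * v = 0" "v * u = 0"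
  shows "iter_square n (u + v) = iter_square n u + iter_square n v
    \<and> iter_square n u * iter_square n v = 0 \<and> iter_square n v * iter_square n u = 0"
proof (induction n)
  case (Suc n)
  have "a * a * (b * b) = 0" if "a * b = 0" for a b :: 'a
    using that by (metis mult.assoc mult_zero_left mult_zero_right)
  then show ?case using Suc by (auto simp: algebra_simps)
qed (use assms in auto)

text \<open>
  The maximum of the norms bounds the sum because powers of the two commuting orthogonal elements
  \<open>u\<^sup>* u\<close> and \<open>v\<^sup>* v\<close> do not mix; the factor 2 of the triangle inequality is absorbed by
  \<open>selfadjoint_norm_le\<close>.
\<close>

lemma norm_orthogonal_sum_le:
  fixes u v :: "'a::cstar_algebra"
  assumes "adj u * v = 0" "u * adj v = 0"
    and u: "norm u \<le> c" and v: "norm v \<le> c"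
  shows "norm (u + v) \<le> c"
proof -
  have vu: "adj v * u = 0" using assms(1) by (metis adj_adj adj_mult adj_zero)
  define h k where "h = adj u * u" and "k = adj v * v"
  have c: "c \<ge> 0" using u norm_ge_zero order_trans by blast
  have sa: "adj h = h" "adj k = k" by (simp_all add: h_def k_def adj_mult adj_adj)
  have "adj u * (u * adj v) * v = 0" using assms(2) by simp
  then have hk: "h * k = 0" by (simp add: h_def k_def mult.assoc)
  then have kh: "k * h = 0" by (metis adj_mult adj_zero sa)
  have nh: "norm h \<le> c\<^sup>2" "norm k \<le> c\<^sup>2"
    using u v by (auto simp: h_def k_def cstar_identity intro: power_mono)
  have "norm (h + k) \<le> c\<^sup>2"
  proof (rule selfadjoint_norm_le[where K=2])
    fix n
    have "norm (iter_square n (h + k)) \<le> norm h ^ 2 ^ n + norm k ^ 2 ^ n"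
      using iter_square_sum_commute[OF hk kh, of n] norm_triangle_ineq[of "iter_square n h" "iter_square n k"]
      by (simp add: norm_iter_square sa)
    also have "\<dots> \<le> 2 * (c\<^sup>2) ^ 2 ^ n"
      using power_mono[OF nh(1) norm_ge_zero, of "2 ^ n"] power_mono[OF nh(2) norm_ge_zero, of "2 ^ n"]
      by linarith
    also have "\<dots> \<le> 2 * 2 ^ n * (c\<^sup>2) ^ 2 ^ n"
      using c by (intro mult_right_mono) auto
    finally show "norm (iter_square n (h + k)) \<le> 2 * 2 ^ n * (c\<^sup>2) ^ 2 ^ n" .
  qed (auto simp: adj_add sa)
  also have "h + k = adj (u + v) * (u + v)"
    using assms(1) vu by (simp add: h_def k_def adj_add algebra_simps)
  finally show ?thesis using c by (simp add: cstar_identity power2_le_iff_abs_le)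
qed

section \<open>Star-homomorphisms are contractive\<close>

locale star_hom_between =
  fixes Y :: "'a::cstar_algebra set" and Z :: "'b::cstar_algebra set" and \<phi> :: "'a \<Rightarrow> 'b"
  assumes subalgebra: "closed_star_subalgebra Y"
    and star_hom: "star_hom (alg_on Y) (alg_on Z) \<phi>"
begin

lemma closed: "closed Y"
  and zero_mem [simp]: "0 \<in> Y"
  and add_mem: "x \<in> Y \<Longrightarrow> y \<in> Y \<Longrightarrow> x + y \<in> Y"
  and mult_mem: "x \<in> Y \<Longrightarrow> y \<in> Y \<Longrightarrow> x * y \<in> Y"
  and adj_mem: "x \<in> Y \<Longrightarrow> adj x \<in> Y"
  and scaleC_mem: "x \<in> Y \<Longrightarrow> c *\<^sub>C x \<in> Y"
  using subalgebra by (auto simp: closed_star_subalgebra_def)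

lemma scaleR_mem: "x \<in> Y \<Longrightarrow> r *\<^sub>R x \<in> Y"
  by (simp add: scaleR_scaleC scaleC_mem)

lemma diff_mem: "x \<in> Y \<Longrightarrow> y \<in> Y \<Longrightarrow> x - y \<in> Y"
  using add_mem[of x "- y"] scaleR_mem[of y "-1"] by simp

lemma sum_mem: "(\<And>i. i \<in> I \<Longrightarrow> f i \<in> Y) \<Longrightarrow> sum f I \<in> Y"
  by (induction I rule: infinite_finite_induct) (auto intro: add_mem)

lemma iter_square_mem: "x \<in> Y \<Longrightarrow> iter_square n x \<in> Y"
  by (induction n) (auto intro: mult_mem)

lemma hom_add: "x \<in> Y \<Longrightarrow> y \<in> Y \<Longrightarrow> \<phi> (x + y) = \<phi> x + \<phi> y"
  and hom_mult: "x \<in> Y \<Longrightarrow> y \<in> Y \<Longrightarrow> \<phi> (x * y) = \<phi> x * \<phi> y"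
  and hom_scaleC: "x \<in> Y \<Longrightarrow> \<phi> (c *\<^sub>C x) = c *\<^sub>C \<phi> x"
  and hom_adj: "x \<in> Y \<Longrightarrow> \<phi> (adj x) = adj (\<phi> x)"
  and hom_mem: "x \<in> Y \<Longrightarrow> \<phi> x \<in> Z"
  using star_hom by (auto simp: star_hom_def alg_on_def)

lemma hom_scaleR: "x \<in> Y \<Longrightarrow> \<phi> (r *\<^sub>R x) = r *\<^sub>R \<phi> x"
  by (simp add: scaleR_scaleC hom_scaleC)

lemma hom_zero [simp]: "\<phi> 0 = 0"
  using hom_add[of 0 0] by simp

lemma hom_diff: "x \<in> Y \<Longrightarrow> y \<in> Y \<Longrightarrow> \<phi> (x - y) = \<phi> x - \<phi> y"
  using hom_add[of x "- y"] hom_scaleR[of y "-1"] scaleR_mem[of y "-1"] by simp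

lemma hom_sum: "(\<And>i. i \<in> I \<Longrightarrow> f i \<in> Y) \<Longrightarrow> \<phi> (sum f I) = (\<Sum>i\<in>I. \<phi> (f i))"
  by (induction I rule: infinite_finite_induct) (auto simp: hom_add sum_mem)

lemma hom_iter_square: "x \<in> Y \<Longrightarrow> \<phi> (iter_square n x) = iter_square n (\<phi> x)"
  by (induction n) (auto simp: hom_mult iter_square_mem)

text \<open>
  The element \<open>c\<close> plays the role of \<open>1 - (1 - a\<^sup>2)\<^bsup>1/2\<^esup>\<close>, so that \<open>a + \<i>(1 - c)\<close> is a unitary of the
  unitization with real part \<open>a\<close>. The equation \<open>c = (a\<^sup>2 + c\<^sup>2) / 2\<close> exhibits it as the fixed point of
  a contraction, which avoids a functional calculus.
\<close>

lemma exists_unitary_complement: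
  assumes a: "a \<in> Y" "adj a = a" "norm a < 1"
  obtains c where "c \<in> Y" "adj c = c" "a * c = c * a" "a * a + c * c = c + c"
proof -
  \<comment> \<open>the smaller root of \<open>r = (\<parallel>a\<parallel>\<^sup>2 + r\<^sup>2) / 2\<close>: the ball of radius \<open>r\<close> is mapped to itself, with Lipschitz constant \<open>r < 1\<close>\<close>
  define r where "r = 1 - sqrt (1 - (norm a)\<^sup>2)"
  have na: "(norm a)\<^sup>2 < 1" using a(3) by (simp add: abs_square_less_1)
  have r: "0 \<le> r" "r < 1" using na by (auto simp: r_def)
  have rr: "(norm a)\<^sup>2 + r\<^sup>2 = 2 * r"
    using na by (simp add: r_def power2_eq_square algebra_simps)
  define C where "C = {c \<in> Y. norm c \<le> r \<and> adj c = c \<and> a * c = c * a}"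
  define f where "f = (\<lambda>c. (1/2) *\<^sub>R (a * a + c * c))"
  have "closed {c. norm c \<le> r \<and> adj c = c \<and> a * c = c * a}"
    by (intro closed_Collect_conj closed_Collect_le closed_Collect_eq continuous_intros)
  then have "closed (Y \<inter> {c. norm c \<le> r \<and> adj c = c \<and> a * c = c * a})"
    using closed by blast
  then have "complete C" by (simp add: C_def complete_eq_closed Collect_conj_eq)
  moreover have "0 \<in> C" using r by (simp add: C_def)
  then have "C \<noteq> {}" by blast
  moreover have "f ` C \<subseteq> C"
  proof (clarsimp simp: C_def)
    fix c assume c: "c \<in> Y" "norm c \<le> r" "adj c = c" "a * c = c * a"
    have "norm (a * a + c * c) \<le> norm a * norm a + norm c * norm c"
      by (meson add_mono norm_mult_ineq norm_triangle_ineq order_trans)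
    also have "\<dots> \<le> (norm a)\<^sup>2 + r\<^sup>2"
      using power_mono[OF c(2) norm_ge_zero, of 2] by (simp add: power2_eq_square)
    finally have "norm (f c) \<le> r" by (simp add: f_def rr)
    moreover have "a * (c * c) = (c * c) * a" by (metis c(4) mult.assoc)
    ultimately show "f c \<in> Y \<and> norm (f c) \<le> r \<and> adj (f c) = f c \<and> a * f c = f c * a"
      using a c
      by (auto simp: f_def adj_scaleR adj_add adj_mult algebra_simps
               intro!: scaleR_mem add_mem mult_mem)
  qed
  moreover have "dist (f x) (f y) \<le> r * dist x y" if "x \<in> C" "y \<in> C" for x y
  proof -
    have "f x - f y = (1/2) *\<^sub>R (x * (x - y) + (x - y) * y)"
      unfolding f_def scaleR_diff_right[symmetric] by (simp add: algebra_simps)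
    then have "norm (f x - f y) \<le> 1/2 * (norm x * norm (x - y) + norm (x - y) * norm y)"
      by (simp add: order_trans[OF norm_triangle_ineq] add_mono norm_mult_ineq)
    also have "\<dots> \<le> 1/2 * (r * norm (x - y) + norm (x - y) * r)"
      using that by (intro mult_left_mono add_mono mult_right_mono) (auto simp: C_def)
    finally show ?thesis by (simp add: dist_norm)
  qed
  ultimately obtain c where c: "c \<in> C" "f c = c"
    using Banach_fix[of C r f] r by blast
  have "2 *\<^sub>R f c = a * a + c * c" by (simp add: f_def)
  then have "a * a + c * c = c + c" using c(2) by (metis scaleR_2)
  then show ?thesis using that c(1) by (auto simp: C_def)
qed

text \<open>
  The image of the unitary \<open>a + \<i>(1 - c)\<close> acts isometrically by left multiplication, and so does its
  adjoint. Left multiplication by \<open>\<phi> a\<close> is the mean of the two, hence contractive; applied to \<open>\<phi> a\<close> itself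
  this gives \<open>\<parallel>\<phi> a\<parallel>\<^sup>2 \<le> \<parallel>\<phi> a\<parallel>\<close>. Working with multiplication operators avoids a norm on the unitization.
\<close>

lemma norm_hom_le_1:
  assumes a: "a \<in> Y" "adj a = a" "norm a < 1"
  shows "norm (\<phi> a) \<le> 1"
proof -
  obtain c where c: "c \<in> Y" "adj c = c" "a * c = c * a" "a * a + c * c = c + c"
    using exists_unitary_complement[OF a] by blast
  define b d where "b = \<phi> a" and "d = \<phi> c"
  have sa: "adj b = b" "adj d = d" and comm: "b * d = d * b" and eq: "b * b + d * d = d + d"
    using a c by (auto simp: b_def d_def hom_adj[symmetric] hom_mult[symmetric] hom_add[symmetric] mult_mem)
  \<comment> \<open>left multiplication by \<open>b + \<i>(1 - d)\<close> and by its adjoint is isometric\<close>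
  have uni: "norm (b * y + z *\<^sub>C (y - d * y)) = norm y" if z: "z = \<i> \<or> z = - \<i>" for y z
  proof -
    define w where "w = y - d * y"
    have zz: "cnj z = - z" "z * z = -1" using z by auto
    have w: "adj w = adj y - adj y * d" by (simp add: w_def adj_diff adj_mult sa)
    have wb: "adj y * b * w = adj w * b * y"
      unfolding w unfolding w_def by (simp add: algebra_simps) (metis comm mult.assoc)
    have dd: "d * (d * y) = d * y + d * y - b * (b * y)"
      using arg_cong[OF eq, of "\<lambda>t. t * y"] by (simp add: algebra_simps)
    have ww: "adj w * w = adj y * y - adj y * (b * (b * y))"
      unfolding w unfolding w_def by (simp add: algebra_simps dd)
    have "adj (b * y + z *\<^sub>C w) * (b * y + z *\<^sub>C w)
        = adj y * (b * (b * y)) + z *\<^sub>C (adj y * b * w) - z *\<^sub>C (adj w * b * y) + adj w * w"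
      by (simp add: adj_add adj_mult adj_scaleC sa zz distrib_left distrib_right mult.assoc
            scaleC_minus_left mult_scaleC_left mult_scaleC_right scaleC_scaleC
            left_diff_distrib right_diff_distrib scaleC_diff_right)
    also have "\<dots> = adj y * y" by (simp add: wb ww)
    finally have "(norm (b * y + z *\<^sub>C w))\<^sup>2 = (norm y)\<^sup>2" by (metis cstar_identity)
    then show ?thesis by (simp add: w_def)
  qed
  define u v where "u = b * b + \<i> *\<^sub>C (b - d * b)" and "v = b * b + (- \<i>) *\<^sub>C (b - d * b)"
  have "2 *\<^sub>R (b * b) = u + v"
    by (simp add: u_def v_def scaleC_minus_left scaleR_2)
  then have "2 * norm (b * b) = norm (u + v)"
    using norm_scaleR[of 2 "b * b"] by simp
  also have "\<dots> \<le> norm u + norm v" by (rule norm_triangle_ineq)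
  also have "norm u = norm b" unfolding u_def by (rule uni) simp
  also have "norm v = norm b" unfolding v_def by (rule uni) simp
  finally have "norm b * norm b \<le> norm b * 1"
    using cstar_identity[of b] by (simp add: sa power2_eq_square)
  then show ?thesis unfolding b_def[symmetric]
    by (cases "norm b = 0") (simp, metis mult_le_cancel_left_pos norm_ge_zero order_le_less)
qed

theorem norm_hom_le:
  assumes "x \<in> Y"
  shows "norm (\<phi> x) \<le> norm x"
proof -
  define h where "h = adj x * x"
  have h: "h \<in> Y" "adj h = h"
    using assms by (auto simp: h_def adj_mult adj_adj intro: mult_mem adj_mem)
  have "norm (\<phi> h) \<le> norm h"
  proof (rule dense_ge)
    fix t assume t: "norm h < t"
    then have t0: "t > 0" using norm_ge_zero[of h] by linarith
    have "norm (\<phi> ((1/t) *\<^sub>R h)) \<le> 1"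
      using h t t0 by (intro norm_hom_le_1) (auto simp: scaleR_mem adj_scaleR)
    then show "norm (\<phi> h) \<le> t" using h t0 by (simp add: hom_scaleR)
  qed
  then have "norm (adj (\<phi> x) * \<phi> x) \<le> norm (adj x * x)"
    using assms by (simp add: h_def hom_mult hom_adj adj_mem)
  then show ?thesis by (rule norm_le_if_adj_mult_le)
qed

end

section \<open>Cuntz-Krieger families indexed by sets and their bihomogeneous elements\<close>

text \<open>
  The relations between generators that the argument uses, for representatives \<open>A\<close> instead of classes:
  \<open>q A\<close> stands for \<open>p\<^bsub>[A]\<^esub>\<close>, \<open>\<rho> a A\<close> for \<open>r(A, a)\<close> and \<open>rg a\<close> for \<open>r(a)\<close>. Additivity of \<open>q\<close> has
  the form \<open>q_split\<close> in which it is applied, and only single letters occur since words are handled by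
  induction.
\<close>

locale cuntz_krieger_family =
  fixes \<B> :: "'v set set" and \<Sigma> :: "'l set"
    and rg :: "'l \<Rightarrow> 'v set" and \<rho> :: "'l \<Rightarrow> 'v set \<Rightarrow> 'v set"
    and s :: "'l \<Rightarrow> 'a::cstar_algebra" and q :: "'v set \<Rightarrow> 'a"
  assumes inter_closed: "A \<in> \<B> \<Longrightarrow> B \<in> \<B> \<Longrightarrow> A \<inter> B \<in> \<B>"
    and union_closed: "A \<in> \<B> \<Longrightarrow> B \<in> \<B> \<Longrightarrow> A \<union> B \<in> \<B>"
    and diff_closed: "A \<in> \<B> \<Longrightarrow> B \<in> \<B> \<Longrightarrow> A - B \<in> \<B>"
    and rg_mem: "a \<in> \<Sigma> \<Longrightarrow> rg a \<in> \<B>"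
    and \<rho>_mem: "a \<in> \<Sigma> \<Longrightarrow> A \<in> \<B> \<Longrightarrow> \<rho> a A \<in> \<B>"
    and q_adj: "A \<in> \<B> \<Longrightarrow> adj (q A) = q A"
    and q_mult: "A \<in> \<B> \<Longrightarrow> B \<in> \<B> \<Longrightarrow> q A * q B = q (A \<inter> B)"
    and q_split: "A \<in> \<B> \<Longrightarrow> B \<in> \<B> \<Longrightarrow> q B = q (B \<inter> A) + q (B - A)"
    and q_s: "A \<in> \<B> \<Longrightarrow> a \<in> \<Sigma> \<Longrightarrow> q A * s a = s a * q (\<rho> a A)"
    and s_isometry: "a \<in> \<Sigma> \<Longrightarrow> s a * adj (s a) * s a = s a"
    and adj_s_s: "a \<in> \<Sigma> \<Longrightarrow> adj (s a) * s a = q (rg a)"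
    and adj_s_s_orth: "a \<in> \<Sigma> \<Longrightarrow> b \<in> \<Sigma> \<Longrightarrow> a \<noteq> b \<Longrightarrow> adj (s a) * s b = 0"
    and q_expand: "A \<in> \<B> \<Longrightarrow> \<exists>W. finite W \<and> W \<subseteq> \<Sigma> \<and>
      q A = (\<Sum>a\<in>W. s a * q (\<rho> a A) * adj (s a))"
begin

lemma norm_q_le_1: "A \<in> \<B> \<Longrightarrow> norm (q A) \<le> 1"
  by (rule norm_projection_le_1) (auto simp: q_mult q_adj)

lemma norm_s_le_1: "a \<in> \<Sigma> \<Longrightarrow> norm (s a) \<le> 1"
  by (rule norm_le_1_if_adj_mult_le_1) (simp add: adj_s_s norm_q_le_1 rg_mem)

text \<open>
  The span of the projections \<open>q A\<close>, generated term by term because the norm estimate on it proceeds by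
  splitting off the last projection.
\<close>

inductive diagonal :: "'a \<Rightarrow> bool" where
  diagonal_zero: "diagonal 0"
| diagonal_add: "diagonal x \<Longrightarrow> A \<in> \<B> \<Longrightarrow> diagonal (x + c *\<^sub>C q A)"

text \<open>
  The span of the elements \<open>s\<^sub>\<mu> q(A) s\<^sub>\<nu>\<^sup>*\<close> with words of lengths \<open>m\<close> and \<open>n\<close>. Generating it one letter at
  a time removes words from the argument, in particular the empty word, for which the algebra need
  not contain an \<open>s\<^sub>\<mu>\<close>. The zero rule makes each span nonempty even if there are no letters.
\<close>

inductive bihom :: "nat \<Rightarrow> nat \<Rightarrow> 'a \<Rightarrow> bool" where
  bihom_q: "A \<in> \<B> \<Longrightarrow> bihom 0 0 (c *\<^sub>C q A)"
| bihom_s: "bihom m n x \<Longrightarrow> a \<in> \<Sigma> \<Longrightarrow> bihom (Suc m) n (s a * x)"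
| bihom_adj_s: "bihom m n x \<Longrightarrow> a \<in> \<Sigma> \<Longrightarrow> bihom m (Suc n) (x * adj (s a))"
| bihom_zero: "bihom m n 0"
| bihom_add: "bihom m n x \<Longrightarrow> bihom m n y \<Longrightarrow> bihom m n (x + y)"

lemma bihom_q': "A \<in> \<B> \<Longrightarrow> bihom 0 0 (q A)"
  using bihom_q[of A 1] by simp

lemma bihom_sum: "(\<And>i. i \<in> I \<Longrightarrow> bihom m n (f i)) \<Longrightarrow> bihom m n (sum f I)"
  by (induction I rule: infinite_finite_induct) (auto intro: bihom_zero bihom_add)

lemma bihom_scaleC: "bihom m n x \<Longrightarrow> bihom m n (c *\<^sub>C x)"
proof (induction rule: bihom.induct)
  case (bihom_q A d)
  then show ?case by (simp add: scaleC_scaleC bihom.bihom_q)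
next
  case (bihom_s m n x a)
  then show ?case by (simp add: mult_scaleC_right[symmetric] bihom.bihom_s)
next
  case (bihom_adj_s m n x a)
  then show ?case by (simp add: mult_scaleC_left[symmetric] bihom.bihom_adj_s)
qed (auto simp: scaleC_add_right intro: bihom_zero bihom_add)

lemma bihom_adj: "bihom m n x \<Longrightarrow> bihom n m (adj x)"
  by (induction rule: bihom.induct)
     (auto simp: adj_add adj_mult adj_adj adj_scaleC q_adj intro: bihom.intros)

lemma bihom_q_mult: "bihom m n x \<Longrightarrow> A \<in> \<B> \<Longrightarrow> bihom m n (q A * x)"
proof (induction arbitrary: A rule: bihom.induct)
  case (bihom_q B c)
  then show ?case by (simp add: mult_scaleC_right q_mult inter_closed bihom.bihom_q)
next
  case (bihom_s m n x a)
  have "q A * (s a * x) = s a * (q (\<rho> a A) * x)"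
    using bihom_s.prems bihom_s.hyps by (simp add: mult.assoc[symmetric] q_s)
  then show ?case using bihom_s by (auto intro: bihom.bihom_s \<rho>_mem)
next
  case (bihom_adj_s m n x a)
  then show ?case using bihom.bihom_adj_s[of m n "q A * x" a] by (simp add: mult.assoc)
qed (auto simp: distrib_left intro: bihom_zero bihom_add)

lemma bihom_mult_q: "bihom m n x \<Longrightarrow> A \<in> \<B> \<Longrightarrow> bihom m n (x * q A)"
  using bihom_adj[OF bihom_q_mult[OF bihom_adj]] by (simp add: adj_mult adj_adj q_adj)

text \<open>
  Expanding the innermost projection by \<open>q A = (\<Sum>a. s a q(\<rho> a A) (s a)\<^sup>*)\<close> lengthens both words by a letter.
\<close>

lemma bihom_Suc_Suc: "bihom m n x \<Longrightarrow> bihom (Suc m) (Suc n) x"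
proof (induction rule: bihom.induct)
  case (bihom_q A c)
  obtain W where W: "finite W" "W \<subseteq> \<Sigma>" "q A = (\<Sum>a\<in>W. s a * q (\<rho> a A) * adj (s a))"
    using q_expand[OF bihom_q] by blast
  have "bihom (Suc 0) (Suc 0) (\<Sum>a\<in>W. s a * q (\<rho> a A) * adj (s a))"
    using W(2) bihom_q
    by (intro bihom_sum bihom.bihom_adj_s bihom.bihom_s bihom_q' \<rho>_mem) auto
  then show ?case using W(3) by (simp add: bihom_scaleC)
qed (auto intro: bihom.intros)

lemma bihom_add_add: "bihom m n x \<Longrightarrow> bihom (m + k) (n + k) x"
  by (induction k) (auto intro: bihom_Suc_Suc)

lemma bihom_adj_s_mult_Suc: "bihom (Suc m) n x \<Longrightarrow> a \<in> \<Sigma> \<Longrightarrow> bihom m n (adj (s a) * x)"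
proof (induction "Suc m" n x rule: bihom.induct)
  case (bihom_s n x b)
  then show ?case
    by (cases "a = b")
       (auto simp: mult.assoc[symmetric] adj_s_s adj_s_s_orth bihom_zero bihom_q_mult rg_mem)
next
  case (bihom_adj_s n x b)
  then show ?case using bihom.bihom_adj_s[of m n "adj (s a) * x" b] by (simp add: mult.assoc)
qed (auto simp: distrib_left intro: bihom_zero bihom_add)

lemma bihom_mult_s: "bihom m (Suc n) x \<Longrightarrow> a \<in> \<Sigma> \<Longrightarrow> bihom m n (x * s a)"
  using bihom_adj[OF bihom_adj_s_mult_Suc[OF bihom_adj]] by (simp add: adj_mult adj_adj)

text \<open>
  Products are controlled when the inner lengths agree: then the letters of the inner words cancel one
  by one. Any two elements can be brought into this position by \<open>bihom_Suc_Suc\<close>.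
\<close>

lemma bihom_mult: "bihom n k y \<Longrightarrow> bihom m n x \<Longrightarrow> bihom m k (x * y)"
proof (induction arbitrary: m x rule: bihom.induct)
  case (bihom_q A c)
  then show ?case by (simp add: mult_scaleC_right bihom_scaleC bihom_mult_q)
next
  case (bihom_s n k y a)
  then show ?case using bihom_mult_s[of m n x a] by (simp add: mult.assoc[symmetric])
next
  case (bihom_adj_s n k y a)
  then show ?case by (simp add: mult.assoc[symmetric] bihom.bihom_adj_s)
qed (auto simp: distrib_left intro: bihom_zero bihom_add)

lemma diagonal_plus: "diagonal y \<Longrightarrow> diagonal x \<Longrightarrow> diagonal (x + y)"
  by (induction rule: diagonal.induct) (auto simp: add.assoc[symmetric] intro: diagonal_add)

lemma diagonal_if_bihom: "bihom 0 0 x \<Longrightarrow> diagonal x"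
proof (induction "0::nat" "0::nat" x rule: bihom.induct)
  case (bihom_q A c)
  then show ?case using diagonal_add[OF diagonal_zero, of A c] by simp
qed (auto intro: diagonal_zero diagonal_plus)

lemma q_empty: "A \<in> \<B> \<Longrightarrow> q {} = 0"
  using q_split[of A A] by simp

lemma diagonal_commute: "diagonal x \<Longrightarrow> A \<in> \<B> \<Longrightarrow> q A * x = x * q A"
  by (induction rule: diagonal.induct)
     (auto simp: algebra_simps mult_scaleC_left mult_scaleC_right q_mult Int_commute)

lemma diagonal_support: "diagonal x \<Longrightarrow> x = 0 \<or> (\<exists>B\<in>\<B>. x * q B = x)"
proof (induction rule: diagonal.induct)
  case (diagonal_add x A c)
  then consider "x = 0" | B where "B \<in> \<B>" "x * q B = x" by blast
  then show ?case
  proof cases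
    case 1
    then show ?thesis using diagonal_add.hyps
      by (intro disjI2 bexI[of _ A]) (simp_all add: mult_scaleC_left q_mult)
  next
    case 2
    then have "x * q (A \<union> B) = x * (q B * q (A \<union> B))"
      by (metis mult.assoc)
    also have "q B * q (A \<union> B) = q B"
      using 2 diagonal_add.hyps by (simp add: q_mult union_closed Int_Un_distrib Un_absorb1)
    finally have "x * q (A \<union> B) = x" using 2 by simp
    moreover have "q A * q (A \<union> B) = q A"
      using 2 diagonal_add.hyps by (simp add: q_mult union_closed Int_absorb2)
    ultimately show ?thesis using 2 diagonal_add.hyps
      by (auto simp: distrib_right mult_scaleC_left union_closed intro!: bexI[of _ "A \<union> B"])
  qed
qed simp

text \<open>
  The sum over a finite set of letters of the range projections; it acts as a local unit on elements
  whose left words are nonempty.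
\<close>

definition range_proj :: "'l set \<Rightarrow> 'a" where
  "range_proj W = (\<Sum>a\<in>W. s a * adj (s a))"

lemma adj_range_proj: "adj (range_proj W) = range_proj W"
  by (simp add: range_proj_def adj_sum adj_mult adj_adj)

lemma range_proj_mult_s:
  assumes "finite W" "W \<subseteq> \<Sigma>" "a \<in> W"
  shows "range_proj W * s a = s a"
proof -
  have "range_proj W * s a = (\<Sum>b\<in>W. s b * (adj (s b) * s a))"
    by (simp add: range_proj_def sum_distrib_right mult.assoc)
  also have "\<dots> = (\<Sum>b\<in>W. if b = a then s a else 0)"
  proof (intro sum.cong refl)
    fix b assume "b \<in> W"
    then have "a \<in> \<Sigma>" "b \<in> \<Sigma>" using assms by auto
    then show "s b * (adj (s b) * s a) = (if b = a then s a else 0)"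
      using adj_s_s_orth[of b a] s_isometry[of a] by (auto simp: mult.assoc)
  qed
  also have "\<dots> = s a" using assms by simp
  finally show ?thesis .
qed

lemma range_proj_support:
  "bihom (Suc m) n x \<Longrightarrow>
    \<exists>W. finite W \<and> W \<subseteq> \<Sigma> \<and> (\<forall>V. finite V \<longrightarrow> W \<subseteq> V \<longrightarrow> V \<subseteq> \<Sigma> \<longrightarrow> range_proj V * x = x)"
proof (induction "Suc m" n x rule: bihom.induct)
  case (bihom_s n x a)
  then show ?case
    by (intro exI[of _ "{a}"]) (auto simp: mult.assoc[symmetric] range_proj_mult_s)
next
  case (bihom_adj_s n x a)
  then show ?case by (metis mult.assoc)
next
  case (bihom_zero n)
  then show ?case by (intro exI[of _ "{}"]) auto
next
  case (bihom_add n x y)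
  then obtain U W where "finite U" "U \<subseteq> \<Sigma>" "finite W" "W \<subseteq> \<Sigma>"
    "\<And>V. finite V \<Longrightarrow> U \<subseteq> V \<Longrightarrow> V \<subseteq> \<Sigma> \<Longrightarrow> range_proj V * x = x"
    "\<And>V. finite V \<Longrightarrow> W \<subseteq> V \<Longrightarrow> V \<subseteq> \<Sigma> \<Longrightarrow> range_proj V * y = y"
    by metis
  then show ?case by (intro exI[of _ "U \<union> W"]) (auto simp: distrib_left)
qed

end

section \<open>Isometry on the core\<close>

locale faithful_on_projections =
  cuntz_krieger_family \<B> \<Sigma> rg \<rho> s q + star_hom_between Y Z \<phi>
  for \<B> :: "'v set set" and \<Sigma> :: "'l set" and rg \<rho>
    and s :: "'l \<Rightarrow> 'a::cstar_algebra" and q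
    and Y Z and \<phi> :: "'a \<Rightarrow> 'b::cstar_algebra" +
  assumes s_mem: "a \<in> \<Sigma> \<Longrightarrow> s a \<in> Y"
    and q_mem: "A \<in> \<B> \<Longrightarrow> q A \<in> Y"
    and hom_q_zeroD: "A \<in> \<B> \<Longrightarrow> \<phi> (q A) = 0 \<Longrightarrow> q A = 0"
begin

lemma bihom_mem: "bihom m n x \<Longrightarrow> x \<in> Y"
  by (induction rule: bihom.induct)
     (auto intro: s_mem q_mem scaleC_mem mult_mem adj_mem add_mem)

lemma diagonal_mem: "diagonal x \<Longrightarrow> x \<in> Y"
  by (induction rule: diagonal.induct) (auto intro: q_mem scaleC_mem add_mem)

lemma hom_q_projection: "A \<in> \<B> \<Longrightarrow> \<phi> (q A) * \<phi> (q A) = \<phi> (q A) \<and> adj (\<phi> (q A)) = \<phi> (q A)"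
  by (simp add: hom_mult[symmetric] hom_adj[symmetric] q_mem q_mult q_adj)

lemma norm_hom_q: "A \<in> \<B> \<Longrightarrow> norm (\<phi> (q A)) = norm (q A)"
  using norm_projection[of "q A"] norm_projection[of "\<phi> (q A)"] hom_q_zeroD[of A] hom_q_projection[of A]
  by (cases "q A = 0") (auto simp: q_mult q_adj)

text \<open>
  Induction over the terms of \<open>x\<close>. The corner at \<open>B\<close> splits into those at \<open>B \<inter> A\<close> and \<open>B - A\<close>: on the
  first, \<open>d q(A)\<close> is the scalar \<open>d\<close>, on the second it vanishes, so both are instances of the claim for
  shorter combinations. The scalar \<open>c\<close> in the claim is there to absorb \<open>d\<close>.
\<close>

lemma norm_diagonal_corner_le:
  "diagonal x \<Longrightarrow> B \<in> \<B> \<Longrightarrow> norm (c *\<^sub>C q B + x * q B) \<le> norm (\<phi> (c *\<^sub>C q B + x * q B))"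
proof (induction arbitrary: c B rule: diagonal.induct)
  case diagonal_zero
  then show ?case by (simp add: norm_scaleC hom_scaleC q_mem norm_hom_q)
next
  case (diagonal_add x A d)
  define w where "w = c *\<^sub>C q B + (x + d *\<^sub>C q A) * q B"
  have A: "A \<in> \<B>" and B: "B \<in> \<B>" and mem: "B \<inter> A \<in> \<B>" "B - A \<in> \<B>"
    using diagonal_add by (auto intro: inter_closed diff_closed)
  have w: "w \<in> Y"
    unfolding w_def using A B diagonal_mem[OF diagonal_add.hyps(1)]
    by (intro add_mem mult_mem scaleC_mem q_mem)
  have qq: "q B * q (B \<inter> A) = q (B \<inter> A)" "q B * q (B - A) = q (B - A)"
    "q A * q (B \<inter> A) = q (B \<inter> A)" "q A * q (B - A) = 0" "q (B \<inter> A) * q (B - A) = 0"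
    using A B mem by (auto simp: q_mult q_empty Int_absorb1 Int_absorb2 intro!: arg_cong[of _ _ q] trans[OF _ q_empty[OF A]])
  have wq: "q C * w = w * q C" if C: "C \<in> \<B>" for C
  proof -
    define y where "y = x + d *\<^sub>C q A"
    have y: "q C * y = y * q C"
      unfolding y_def using diagonal_add.hyps C by (intro diagonal_commute diagonal.diagonal_add)
    have "q C * (y * q B) = y * (q C * q B)" by (metis mult.assoc y)
    then show ?thesis using B C
      by (simp add: w_def y_def[symmetric] distrib_left distrib_right mult.assoc
            mult_scaleC_left mult_scaleC_right q_mult Int_commute)
  qed
  have eq1: "w * q (B \<inter> A) = (c + d) *\<^sub>C q (B \<inter> A) + x * q (B \<inter> A)"
    by (simp add: w_def distrib_right mult.assoc qq mult_scaleC_left scaleC_add_left)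
  have eq2: "w * q (B - A) = c *\<^sub>C q (B - A) + x * q (B - A)"
    by (simp add: w_def distrib_right mult.assoc qq mult_scaleC_left)
  have le: "norm (w * q C) \<le> norm (\<phi> w)"
    if "C \<in> \<B>" "norm (w * q C) \<le> norm (\<phi> (w * q C))" for C
    using that hom_q_projection[OF that(1)] norm_mult_projection_le[of "\<phi> (q C)" "\<phi> w"]
    by (simp add: hom_mult w q_mem)
  have "norm (w * q (B \<inter> A) + w * q (B - A)) \<le> norm (\<phi> w)"
  proof (rule norm_orthogonal_sum_le)
    have "adj (q (B \<inter> A) * w) * (q (B - A) * w) = adj w * (q (B \<inter> A) * q (B - A)) * w"
      using mem by (simp only: adj_mult q_adj mult.assoc)
    then show "adj (w * q (B \<inter> A)) * (w * q (B - A)) = 0"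
      using mem by (simp add: wq qq)
    have "w * q (B \<inter> A) * adj (w * q (B - A)) = w * (q (B \<inter> A) * q (B - A)) * adj w"
      using mem by (simp only: adj_mult q_adj mult.assoc)
    then show "w * q (B \<inter> A) * adj (w * q (B - A)) = 0"
      by (simp add: qq)
    show "norm (w * q (B \<inter> A)) \<le> norm (\<phi> w)"
      using diagonal_add.IH[OF mem(1), of "c + d"] by (intro le mem) (simp add: eq1)
    show "norm (w * q (B - A)) \<le> norm (\<phi> w)"
      using diagonal_add.IH[OF mem(2), of c] by (intro le mem) (simp add: eq2)
  qed
  also have "w * q (B \<inter> A) + w * q (B - A) = w * q B"
    using q_split[OF A B] by (simp add: distrib_left)
  also have "w * q B = w"
    using B by (simp add: w_def distrib_right mult.assoc mult_scaleC_left q_mult)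
  finally show ?case by (simp add: w_def)
qed

lemma norm_diagonal_le: "diagonal x \<Longrightarrow> norm x \<le> norm (\<phi> x)"
  using diagonal_support[of x] norm_diagonal_corner_le[of x _ 0] by (metis add_0 hom_zero norm_zero order_refl scaleC_zero_left)

lemma selfadjoint_isometry:
  assumes h: "h \<in> Y" "adj h = h"
    and bound: "\<And>n. norm (iter_square n h) \<le> K * 2 ^ n * norm (\<phi> (iter_square n h))"
    and K: "K \<ge> 0"
  shows "norm h \<le> norm (\<phi> h)"
proof (rule selfadjoint_norm_le[OF h(2) norm_ge_zero])
  fix n
  have "K * 2 ^ n * norm (\<phi> (iter_square n h)) \<le> K * 2 ^ n * norm (\<phi> h) ^ 2 ^ n"
    using K norm_iter_square_le[of n "\<phi> h"]
    by (intro mult_left_mono) (auto simp: hom_iter_square h)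
  then show "norm (iter_square n h) \<le> K * 2 ^ n * norm (\<phi> h) ^ 2 ^ n"
    using bound[of n] by (rule order_trans[rotated])
qed

lemma norm_hom_s_le_1: "a \<in> \<Sigma> \<Longrightarrow> norm (\<phi> (s a)) \<le> 1"
  using norm_hom_le[of "s a"] norm_s_le_1[of a] s_mem[of a] by simp

text \<open>
  The element \<open>x\<close> is the matrix with entries \<open>s\<^sub>a\<^sup>* x s\<^sub>b\<close>, which are one level lower and whose images
  have norm at most \<open>\<parallel>\<phi> x\<parallel>\<close>. The constant depends on \<open>W\<close> only, so it serves all powers of \<open>x\<close> at once.
\<close>

lemma norm_bihom_matrix_le:
  assumes IH: "\<And>y. bihom n n y \<Longrightarrow> norm y \<le> norm (\<phi> y)"
    and W: "finite W" "W \<subseteq> \<Sigma>"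
    and x: "bihom (Suc n) (Suc n) x" "range_proj W * x = x" "x * range_proj W = x"
  shows "norm x \<le> (real (card W))\<^sup>2 * norm (\<phi> x)"
proof -
  have "x = range_proj W * x * range_proj W" by (simp add: x)
  also have "\<dots> = (\<Sum>a\<in>W. \<Sum>b\<in>W. s a * (adj (s a) * x * s b) * adj (s b))"
    by (simp add: range_proj_def sum_distrib_left sum_distrib_right mult.assoc) (rule sum.swap)
  finally have "norm x = norm \<dots>" by simp
  also have "\<dots> \<le> (\<Sum>a\<in>W. \<Sum>b\<in>W. norm (s a * (adj (s a) * x * s b) * adj (s b)))"
    by (intro order_trans[OF norm_sum] sum_mono norm_sum)
  also have "\<dots> \<le> (\<Sum>a\<in>W. \<Sum>b\<in>W. norm (\<phi> x))"
  proof (intro sum_mono)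
    fix a b assume "a \<in> W" "b \<in> W"
    then have ab: "a \<in> \<Sigma>" "b \<in> \<Sigma>" using W by auto
    have "norm (s a * (adj (s a) * x * s b) * adj (s b)) \<le> norm (adj (s a) * x * s b)"
      using ab by (intro norm_mult_contractions_le) (auto simp: norm_s_le_1)
    also have "\<dots> \<le> norm (\<phi> (adj (s a) * x * s b))"
      using ab x by (intro IH bihom_mult_s bihom_adj_s_mult_Suc)
    also have "\<phi> (adj (s a) * x * s b) = adj (\<phi> (s a)) * \<phi> x * \<phi> (s b)"
      using ab bihom_mem[OF x(1)] by (simp add: hom_mult hom_adj s_mem adj_mem mult_mem)
    also have "norm \<dots> \<le> norm (\<phi> x)"
      using ab by (intro norm_mult_contractions_le) (auto simp: norm_hom_s_le_1)
    finally show "norm (s a * (adj (s a) * x * s b) * adj (s b)) \<le> norm (\<phi> x)" .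
  qed
  also have "\<dots> = (real (card W))\<^sup>2 * norm (\<phi> x)" by (simp add: power2_eq_square)
  finally show ?thesis .
qed

lemma norm_bihom_le: "bihom n n x \<Longrightarrow> norm x \<le> norm (\<phi> x)"
proof (induction n arbitrary: x)
  case 0
  then show ?case by (intro norm_diagonal_le diagonal_if_bihom)
next
  case (Suc n)
  define h where "h = adj x * x"
  have h: "bihom (Suc n) (Suc n) h" "adj h = h"
    unfolding h_def using Suc.prems by (auto intro: bihom_mult bihom_adj simp: adj_mult adj_adj)
  obtain W where W: "finite W" "W \<subseteq> \<Sigma>" "range_proj W * h = h"
    using range_proj_support[OF h(1)] by blast
  then have "adj (range_proj W * h) = adj h" by simp
  then have W': "h * range_proj W = h" by (simp add: adj_mult adj_range_proj h)
  have it: "bihom (Suc n) (Suc n) (iter_square k h) \<and> range_proj W * iter_square k h = iter_square k h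
      \<and> iter_square k h * range_proj W = iter_square k h" for k
  proof (induction k)
    case (Suc k)
    then show ?case by (auto intro: bihom_mult simp: mult.assoc) (metis mult.assoc)
  qed (use h W W' in auto)
  have "norm h \<le> norm (\<phi> h)"
  proof (rule selfadjoint_isometry[where K="(real (card W))\<^sup>2"])
    fix k
    have "norm (iter_square k h) \<le> (real (card W))\<^sup>2 * norm (\<phi> (iter_square k h))"
      using it[of k] W Suc.IH by (intro norm_bihom_matrix_le) auto
    also have "\<dots> \<le> (real (card W))\<^sup>2 * 2 ^ k * norm (\<phi> (iter_square k h))"
      by (intro mult_right_mono) (auto simp: mult_le_cancel_left1)
    finally show "norm (iter_square k h) \<le> (real (card W))\<^sup>2 * 2 ^ k * norm (\<phi> (iter_square k h))" .
  qed (use h bihom_mem[OF h(1)] in auto)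
  then have "norm (adj x * x) \<le> norm (adj (\<phi> x) * \<phi> x)"
    using bihom_mem[OF Suc.prems] by (simp add: h_def hom_mult hom_adj adj_mem)
  then show ?case by (rule norm_le_if_adj_mult_le)
qed

end

section \<open>Gauge grading and uniqueness\<close>

lemma sum_roots_of_unity:
  fixes d :: int
  assumes N: "N > 0" and d: "\<bar>d\<bar> < int N"
  shows "(\<Sum>l<N. cis (2 * pi * of_int d * real l / real N)) = (if d = 0 then of_nat N else 0)"
proof (cases "d = 0")
  case False
  define w where "w = cis (2 * pi * of_int d / real N)"
  have "w \<noteq> 1"
  proof
    assume "w = 1"
    then have "cos (2 * pi * of_int d / real N) = 1" by (simp add: w_def complex_eq_iff)
    then obtain k :: int where "2 * pi * of_int d / real N = of_int k * 2 * pi"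
      by (auto simp: cos_one_2pi_int)
    then have "of_int d = (of_int (k * int N) :: real)" using N by (simp add: field_simps)
    then have "d = k * int N" by linarith
    moreover have "k \<noteq> 0" using calculation False by auto
    then have "1 \<le> \<bar>k\<bar>" by simp
    then have "int N \<le> \<bar>k * int N\<bar>" by (simp add: abs_mult mult_le_cancel_right1)
    ultimately show False using d by simp
  qed
  moreover have "w ^ N = 1"
  proof -
    have "w ^ N = cis (real N * (2 * pi * of_int d / real N))" by (simp only: w_def Complex.DeMoivre)
    also have "real N * (2 * pi * of_int d / real N) = 2 * pi * of_int d" using N by simp
    also have "cis (2 * pi * of_int d) = 1" by (rule cis_multiple_2pi) simp
    finally show ?thesis .
  qed
  ultimately have "(\<Sum>l<N. w ^ l) = 0" by (simp add: geometric_sum)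
  then show ?thesis using False by (simp add: w_def Complex.DeMoivre mult.commute mult.left_commute)
qed simp

lemma closed_star_subalgebra_closure:
  fixes A :: "'a::cstar_algebra set"
  assumes "0 \<in> A" "\<And>x y. x \<in> A \<Longrightarrow> y \<in> A \<Longrightarrow> x + y \<in> A"
    "\<And>x y. x \<in> A \<Longrightarrow> y \<in> A \<Longrightarrow> x * y \<in> A" "\<And>x. x \<in> A \<Longrightarrow> adj x \<in> A"
    "\<And>c x. x \<in> A \<Longrightarrow> c *\<^sub>C x \<in> A"
  shows "closed_star_subalgebra (closure A)"
proof -
  have "x + y \<in> closure A \<and> x * y \<in> closure A" if xy: "x \<in> closure A" "y \<in> closure A" for x y
  proof -
    obtain f where f: "\<forall>n. f n \<in> A" "f \<longlonglongrightarrow> x"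
      using xy(1) unfolding closure_sequential by blast
    obtain g where g: "\<forall>n. g n \<in> A" "g \<longlonglongrightarrow> y"
      using xy(2) unfolding closure_sequential by blast
    have "x + y \<in> closure A" unfolding closure_sequential
      by (rule exI[of _ "\<lambda>n. f n + g n"]) (use f g assms(2) in \<open>auto intro: tendsto_add\<close>)
    moreover have "x * y \<in> closure A" unfolding closure_sequential
      by (rule exI[of _ "\<lambda>n. f n * g n"]) (use f g assms(3) in \<open>auto intro: tendsto_mult\<close>)
    ultimately show ?thesis by blast
  qed
  moreover have "adj x \<in> closure A \<and> c *\<^sub>C x \<in> closure A" if x: "x \<in> closure A" for x c
  proof -
    obtain f where f: "\<forall>n. f n \<in> A" "f \<longlonglongrightarrow> x"
      using x unfolding closure_sequential by blast
    have "adj x \<in> closure A" unfolding closure_sequential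
      by (rule exI[of _ "\<lambda>n. adj (f n)"]) (use f assms(4) in \<open>auto intro: bounded_linear.tendsto[OF bounded_linear_adj]\<close>)
    moreover have "c *\<^sub>C x \<in> closure A" unfolding closure_sequential
      by (rule exI[of _ "\<lambda>n. c *\<^sub>C f n"]) (use f assms(5) in \<open>auto intro: bounded_linear.tendsto[OF bounded_linear_scaleC]\<close>)
    ultimately show ?thesis by blast
  qed
  ultimately show ?thesis
    using assms(1) closure_subset[of A] by (auto simp: closed_star_subalgebra_def)
qed

context cuntz_krieger_family begin

text \<open>
  Degree \<open>j\<close> for the gauge action.
\<close>

definition homogeneous :: "int \<Rightarrow> 'a \<Rightarrow> bool" where
  "homogeneous j x \<longleftrightarrow> (\<exists>m n. bihom m n x \<and> int m - int n = j)"

lemma homogeneous_zero: "homogeneous j 0"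
  unfolding homogeneous_def by (rule exI[of _ "nat j"], rule exI[of _ "nat (- j)"]) (auto intro: bihom_zero)

lemma homogeneous_q: "A \<in> \<B> \<Longrightarrow> homogeneous 0 (q A)"
  unfolding homogeneous_def using bihom_q' by fastforce

lemma homogeneous_s:
  assumes "a \<in> \<Sigma>"
  shows "homogeneous 1 (s a)"
proof -
  have "bihom 1 0 (s a * q (rg a))"
    using bihom_s[OF bihom_q'[OF rg_mem[OF assms]] assms] by simp
  also have "s a * q (rg a) = s a"
    using s_isometry[OF assms] adj_s_s[OF assms] by (simp add: mult.assoc)
  finally show ?thesis unfolding homogeneous_def by fastforce
qed

lemma homogeneous_scaleC: "homogeneous j x \<Longrightarrow> homogeneous j (c *\<^sub>C x)"
  unfolding homogeneous_def using bihom_scaleC by blast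

lemma homogeneous_adj: "homogeneous j x \<Longrightarrow> homogeneous (- j) (adj x)"
  unfolding homogeneous_def by (force dest: bihom_adj)

lemma homogeneous_add:
  assumes "homogeneous j x" "homogeneous j y"
  shows "homogeneous j (x + y)"
proof -
  obtain m n k l where *: "bihom m n x" "bihom k l y" "int m - int n = j" "int k - int l = j"
    using assms unfolding homogeneous_def by blast
  have "bihom (m + k) (n + k) x" using *(1) by (rule bihom_add_add)
  moreover have "bihom (k + m) (l + m) y" using *(2) by (rule bihom_add_add)
  moreover have "l + m = n + k" using *(3,4) by linarith
  ultimately have "bihom (m + k) (n + k) (x + y)" by (simp add: add.commute bihom_add)
  then show ?thesis unfolding homogeneous_def using *(3) by force
qed

lemma homogeneous_mult:
  assumes "homogeneous i x" "homogeneous j y"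
  shows "homogeneous (i + j) (x * y)"
proof -
  obtain m n k l where *: "bihom m n x" "bihom k l y" "int m - int n = i" "int k - int l = j"
    using assms unfolding homogeneous_def by blast
  have "bihom (m + k) (n + k) x" using *(1) by (rule bihom_add_add)
  moreover have "bihom (n + k) (l + n) y" using bihom_add_add[OF *(2), of n] by (simp add: add.commute)
  ultimately have "bihom (m + k) (l + n) (x * y)" using bihom_mult by blast
  then show ?thesis unfolding homogeneous_def using *(3,4) by force
qed

text \<open>
  Finite sums of homogeneous elements of degrees between \<open>-M\<close> and \<open>M\<close>, the Laurent polynomials of the
  grading. The bound \<open>M\<close> is recorded because it enters the norm estimate.
\<close>

definition laurent :: "nat \<Rightarrow> 'a \<Rightarrow> bool" where
  "laurent M x \<longleftrightarrow> (\<exists>f. (\<forall>j. homogeneous j (f j)) \<and> x = (\<Sum>j\<in>{- int M..int M}. f j))"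

lemma laurent_homogeneous:
  assumes "homogeneous j x" "\<bar>j\<bar> \<le> int M"
  shows "laurent M x"
  unfolding laurent_def using assms
  by (intro exI[of _ "\<lambda>i. if i = j then x else 0"]) (auto intro: homogeneous_zero)

lemma laurent_zero: "laurent M 0"
  by (rule laurent_homogeneous[of 0]) (auto intro: homogeneous_zero)

lemma laurent_add:
  assumes "laurent M x" "laurent M y"
  shows "laurent M (x + y)"
proof -
  obtain f g where "\<forall>j. homogeneous j (f j)" "x = (\<Sum>j\<in>{- int M..int M}. f j)"
    "\<forall>j. homogeneous j (g j)" "y = (\<Sum>j\<in>{- int M..int M}. g j)"
    using assms unfolding laurent_def by blast
  then show ?thesis unfolding laurent_def
    by (intro exI[of _ "\<lambda>j. f j + g j"]) (auto simp: sum.distrib intro: homogeneous_add)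
qed

lemma laurent_sum: "(\<And>i. i \<in> I \<Longrightarrow> laurent M (f i)) \<Longrightarrow> laurent M (sum f I)"
  by (induction I rule: infinite_finite_induct) (auto intro: laurent_zero laurent_add)

lemma laurent_mult:
  assumes "laurent M x" "laurent N y"
  shows "laurent (M + N) (x * y)"
proof -
  obtain f g where f: "\<forall>j. homogeneous j (f j)" "x = (\<Sum>j\<in>{- int M..int M}. f j)"
    and g: "\<forall>j. homogeneous j (g j)" "y = (\<Sum>j\<in>{- int N..int N}. g j)"
    using assms unfolding laurent_def by blast
  show ?thesis unfolding f(2) g(2) sum_product
    using f(1) g(1) by (intro laurent_sum laurent_homogeneous[OF homogeneous_mult]) auto
qed

lemma laurent_adj:
  assumes "laurent M x"
  shows "laurent M (adj x)"
proof -
  obtain f where f: "\<forall>j. homogeneous j (f j)" "x = (\<Sum>j\<in>{- int M..int M}. f j)"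
    using assms unfolding laurent_def by blast
  show ?thesis unfolding f(2) adj_sum
    using f(1) by (intro laurent_sum laurent_homogeneous[OF homogeneous_adj]) auto
qed

lemma laurent_scaleC:
  assumes "laurent M x"
  shows "laurent M (c *\<^sub>C x)"
proof -
  obtain f where f: "\<forall>j. homogeneous j (f j)" "x = (\<Sum>j\<in>{- int M..int M}. f j)"
    using assms unfolding laurent_def by blast
  show ?thesis unfolding f(2) scaleC_sum_right
    using f(1) by (intro laurent_sum laurent_homogeneous[OF homogeneous_scaleC]) auto
qed

lemma laurent_mono:
  assumes "laurent M x" "M \<le> N"
  shows "laurent N x"
proof -
  obtain f where f: "\<forall>j. homogeneous j (f j)" "x = (\<Sum>j\<in>{- int M..int M}. f j)"
    using assms unfolding laurent_def by blast
  show ?thesis unfolding f(2)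
    using f(1) assms(2) by (intro laurent_sum laurent_homogeneous[of _ "f _"]) auto
qed

lemma laurent_iter_square: "laurent M x \<Longrightarrow> laurent (M * 2 ^ n) (iter_square n x)"
proof (induction n)
  case (Suc n)
  then show ?case using laurent_mult[of "M * 2 ^ n" _ "M * 2 ^ n"] by (simp add: mult_2 distrib_left)
qed simp

text \<open>
  The Laurent polynomials of arbitrary degree form a star-algebra containing the generators.
\<close>

lemma generated_subset_closure_laurent:
  "cstar_generated (s ` \<Sigma> \<union> q ` \<B>) \<subseteq> closure {x. \<exists>M. laurent M x}"
proof -
  define A where "A = {x. \<exists>M. laurent M x}"
  have "closed_star_subalgebra (closure A)"
  proof (rule closed_star_subalgebra_closure)
    fix x y assume "x \<in> A" "y \<in> A"
    then obtain M N where MN: "laurent M x" "laurent N y" by (auto simp: A_def)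
    then have "laurent (M + N) x" "laurent (M + N) y" by (auto intro: laurent_mono)
    then show "x + y \<in> A" unfolding A_def by (blast intro: laurent_add)
    show "x * y \<in> A" unfolding A_def using MN by (blast intro: laurent_mult)
  qed (auto simp: A_def intro: laurent_zero laurent_adj laurent_scaleC)
  moreover have "s ` \<Sigma> \<union> q ` \<B> \<subseteq> closure A"
  proof -
    have "laurent 1 (s a)" if "a \<in> \<Sigma>" for a
      using homogeneous_s[OF that] by (rule laurent_homogeneous) simp
    moreover have "laurent 0 (q A)" if "A \<in> \<B>" for A
      using homogeneous_q[OF that] by (rule laurent_homogeneous) simp
    ultimately show ?thesis using closure_subset[of A] by (auto simp: A_def)
  qed
  ultimately show ?thesis unfolding cstar_generated_def A_def by blast
qed

end

locale gauge_equivariant = faithful_on_projections \<B> \<Sigma> rg \<rho> s q Y Z \<phi>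
  for \<B> :: "'v set set" and \<Sigma> :: "'l set" and rg \<rho>
    and s :: "'l \<Rightarrow> 'a::cstar_algebra" and q
    and Y Z and \<phi> :: "'a \<Rightarrow> 'b::cstar_algebra" +
  fixes \<beta> :: "complex \<Rightarrow> 'b \<Rightarrow> 'b"
  assumes target_subalgebra: "closed_star_subalgebra Z"
    and \<beta>_star_hom: "cmod z = 1 \<Longrightarrow> star_hom (alg_on Z) (alg_on Z) (\<beta> z)"
    and \<beta>_s: "cmod z = 1 \<Longrightarrow> a \<in> \<Sigma> \<Longrightarrow> \<beta> z (\<phi> (s a)) = z *\<^sub>C \<phi> (s a)"
    and \<beta>_q: "cmod z = 1 \<Longrightarrow> A \<in> \<B> \<Longrightarrow> \<beta> z (\<phi> (q A)) = \<phi> (q A)"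
begin

lemma homogeneous_mem: "homogeneous j x \<Longrightarrow> x \<in> Y"
  unfolding homogeneous_def using bihom_mem by blast

lemma \<beta>_hom: "cmod z = 1 \<Longrightarrow> star_hom_between Z Z (\<beta> z)"
  by (simp add: star_hom_between_def target_subalgebra \<beta>_star_hom)

lemma \<beta>_bihom:
  assumes z: "cmod z = 1"
  shows "bihom m n x \<Longrightarrow> \<beta> z (\<phi> x) = (z ^ m * cnj z ^ n) *\<^sub>C \<phi> x"
proof (induction rule: bihom.induct)
  interpret \<beta>: star_hom_between Z Z "\<beta> z" by (rule \<beta>_hom[OF z])
  {
    case (bihom_q A c)
    then show ?case by (simp add: hom_scaleC q_mem \<beta>.hom_scaleC hom_mem \<beta>_q z)
  next
    case (bihom_s m n x a)
    then show ?case
      by (simp add: hom_mult s_mem bihom_mem \<beta>.hom_mult hom_mem \<beta>_s z mult_scaleC_left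
            mult_scaleC_right scaleC_scaleC mult.assoc mult.commute mult.left_commute)
  next
    case (bihom_adj_s m n x a)
    then show ?case
      by (simp add: hom_mult s_mem adj_mem hom_adj bihom_mem \<beta>.hom_mult \<beta>.hom_adj \<beta>.adj_mem hom_mem \<beta>_s z
            mult_scaleC_left mult_scaleC_right scaleC_scaleC adj_scaleC mult.assoc mult.commute mult.left_commute)
  next
    case bihom_zero
    then show ?case by simp
  next
    case (bihom_add m n x y)
    then show ?case by (simp add: hom_add bihom_mem \<beta>.hom_add hom_mem scaleC_add_right)
  }
qed

lemma \<beta>_homogeneous:
  assumes "homogeneous j x"
  shows "\<beta> (cis t) (\<phi> x) = cis (of_int j * t) *\<^sub>C \<phi> x"
proof -
  obtain m n where mn: "bihom m n x" "int m - int n = j" using assms unfolding homogeneous_def by blast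
  have "cis t ^ m * cnj (cis t) ^ n = cis (of_int j * t)"
  proof -
    have "cis t ^ m * cnj (cis t) ^ n = cis (real m * t + real n * (- t))"
      by (simp only: cis_cnj Complex.DeMoivre cis_mult)
    also have "real m * t + real n * (- t) = of_int j * t"
      unfolding mn(2)[symmetric] by (simp add: algebra_simps)
    finally show ?thesis .
  qed
  then show ?thesis using \<beta>_bihom[OF _ mn(1), of "cis t"] by simp
qed

text \<open>
  With \<open>N = 2M + 1\<close> the degrees from \<open>-M\<close> to \<open>M\<close> are pairwise incongruent modulo \<open>N\<close>, so averaging over
  the \<open>N\<close>-th roots of unity already isolates one coefficient, and no integral over the circle is needed.
\<close>

lemma norm_coefficient_le:
  assumes f: "\<And>j. homogeneous j (f j)" and x: "x = (\<Sum>j\<in>{- int M..int M}. f j)" and k: "k \<in> {- int M..int M}"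
  shows "norm (\<phi> (f k)) \<le> norm (\<phi> x)"
proof -
  define N where "N = 2 * M + 1"
  define I where "I = {- int M..int M}"
  define t where "t l = 2 * pi * real l / real N" for l
  have fY: "f j \<in> Y" for j using f homogeneous_mem by blast
  have xY: "x \<in> Y" unfolding x by (intro sum_mem fY)
  have \<beta>x: "\<beta> (cis (t l)) (\<phi> x) = (\<Sum>j\<in>I. cis (of_int j * t l) *\<^sub>C \<phi> (f j))" for l
  proof -
    interpret \<beta>: star_hom_between Z Z "\<beta> (cis (t l))" by (rule \<beta>_hom) simp
    show ?thesis
      unfolding x I_def by (simp add: hom_sum fY \<beta>.hom_sum hom_mem \<beta>_homogeneous[OF f])
  qed
  have "(\<Sum>l<N. cis (- of_int k * t l) *\<^sub>C \<beta> (cis (t l)) (\<phi> x))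
      = (\<Sum>l<N. \<Sum>j\<in>I. cis (2 * pi * of_int (j - k) * real l / real N) *\<^sub>C \<phi> (f j))"
  proof (intro sum.cong refl)
    fix l
    have angle: "- of_int k * t l + of_int j * t l = 2 * pi * of_int (j - k) * real l / real N" for j
      by (simp add: t_def left_diff_distrib right_diff_distrib diff_divide_distrib mult_ac)
    show "cis (- of_int k * t l) *\<^sub>C \<beta> (cis (t l)) (\<phi> x)
        = (\<Sum>j\<in>I. cis (2 * pi * of_int (j - k) * real l / real N) *\<^sub>C \<phi> (f j))"
      unfolding \<beta>x scaleC_sum_right scaleC_scaleC cis_mult angle ..
  qed
  also have "\<dots> = (\<Sum>j\<in>I. (\<Sum>l<N. cis (2 * pi * of_int (j - k) * real l / real N)) *\<^sub>C \<phi> (f j))"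
    by (subst sum.swap) (simp add: scaleC_sum_left)
  also have "\<dots> = (\<Sum>j\<in>I. if j = k then of_nat N *\<^sub>C \<phi> (f k) else 0)"
  proof (intro sum.cong refl)
    fix j assume "j \<in> I"
    then have "\<bar>j - k\<bar> < int N" using k by (auto simp: I_def N_def)
    then show "(\<Sum>l<N. cis (2 * pi * of_int (j - k) * real l / real N)) *\<^sub>C \<phi> (f j)
        = (if j = k then of_nat N *\<^sub>C \<phi> (f k) else 0)"
      by (subst sum_roots_of_unity) (auto simp: N_def)
  qed
  also have "\<dots> = of_nat N *\<^sub>C \<phi> (f k)" using k by (simp add: I_def)
  finally have "real N * norm (\<phi> (f k)) = norm (\<Sum>l<N. cis (- of_int k * t l) *\<^sub>C \<beta> (cis (t l)) (\<phi> x))"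
    by (simp add: norm_scaleC)
  also have "\<dots> \<le> (\<Sum>l<N. norm (\<phi> x))"
  proof (rule sum_norm_le)
    fix l
    interpret \<beta>: star_hom_between Z Z "\<beta> (cis (t l))" by (rule \<beta>_hom) simp
    show "norm (cis (- of_int k * t l) *\<^sub>C \<beta> (cis (t l)) (\<phi> x)) \<le> norm (\<phi> x)"
      using \<beta>.norm_hom_le[OF hom_mem[OF xY]] by (simp add: norm_scaleC)
  qed
  finally show ?thesis by (simp add: N_def mult_le_cancel_left)
qed

lemma norm_homogeneous_le:
  assumes "homogeneous j x"
  shows "norm x \<le> norm (\<phi> x)"
proof -
  obtain m n where x: "bihom m n x" using assms unfolding homogeneous_def by blast
  have "norm (adj x * x) \<le> norm (\<phi> (adj x * x))"
    by (rule norm_bihom_le[OF bihom_mult[OF x bihom_adj[OF x]]])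
  then have "norm (adj x * x) \<le> norm (adj (\<phi> x) * \<phi> x)"
    using bihom_mem[OF x] by (simp add: hom_mult hom_adj adj_mem)
  then show ?thesis by (rule norm_le_if_adj_mult_le)
qed

lemma laurent_mem: "laurent M x \<Longrightarrow> x \<in> Y"
  unfolding laurent_def using homogeneous_mem by (auto intro: sum_mem)

lemma norm_laurent_le_mult:
  assumes "laurent M x"
  shows "norm x \<le> real (2 * M + 1) * norm (\<phi> x)"
proof -
  obtain f where f: "\<And>j. homogeneous j (f j)" "x = (\<Sum>j\<in>{- int M..int M}. f j)"
    using assms unfolding laurent_def by blast
  have "norm x \<le> (\<Sum>j\<in>{- int M..int M}. norm (\<phi> x))"
    unfolding f(2)
  proof (rule sum_norm_le, unfold f(2)[symmetric])
    fix j assume "j \<in> {- int M..int M}"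
    then show "norm (f j) \<le> norm (\<phi> x)"
      using norm_homogeneous_le[OF f(1)[of j]] norm_coefficient_le[OF f, of j] by linarith
  qed
  then show ?thesis by (simp add: nat_add_distrib)
qed

text \<open>
  Here \<open>h = x\<^sup>* x\<close> and its \<open>2\<^sup>n\<close>-th power have degrees at most \<open>2M\<close> and \<open>2M 2\<^sup>n\<close>, so the number of
  homogeneous parts is at most \<open>(4M + 1) 2\<^sup>n\<close>, the linear growth that \<open>selfadjoint_isometry\<close> tolerates.
\<close>

lemma norm_laurent_le:
  assumes "laurent M x"
  shows "norm x \<le> norm (\<phi> x)"
proof -
  define h where "h = adj x * x"
  have h: "laurent (M + M) h" unfolding h_def using assms by (intro laurent_mult laurent_adj)
  have "norm h \<le> norm (\<phi> h)"
  proof (rule selfadjoint_isometry[where K="real (4 * M + 1)"])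
    fix n
    have "real (2 * ((M + M) * 2 ^ n) + 1) \<le> real ((4 * M + 1) * 2 ^ n)"
      by (subst of_nat_le_iff) (simp add: algebra_simps)
    also have "\<dots> = real (4 * M + 1) * 2 ^ n" by (simp add: algebra_simps)
    finally have "real (2 * ((M + M) * 2 ^ n) + 1) \<le> real (4 * M + 1) * 2 ^ n" .
    then have "real (2 * ((M + M) * 2 ^ n) + 1) * norm (\<phi> (iter_square n h))
        \<le> real (4 * M + 1) * 2 ^ n * norm (\<phi> (iter_square n h))"
      by (intro mult_right_mono) auto
    then show "norm (iter_square n h) \<le> real (4 * M + 1) * 2 ^ n * norm (\<phi> (iter_square n h))"
      using norm_laurent_le_mult[OF laurent_iter_square[OF h, of n]] by linarith
  qed (use laurent_mem[OF h] in \<open>auto simp: h_def adj_mult adj_adj\<close>)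
  then have "norm (adj x * x) \<le> norm (adj (\<phi> x) * \<phi> x)"
    using laurent_mem[OF assms] by (simp add: h_def hom_mult hom_adj adj_mem)
  then show ?thesis by (rule norm_le_if_adj_mult_le)
qed

lemma norm_generated_le:
  assumes "x \<in> Y" "x \<in> cstar_generated (s ` \<Sigma> \<union> q ` \<B>)"
  shows "norm x \<le> norm (\<phi> x)"
proof -
  have "x \<in> closure {x. \<exists>M. laurent M x}"
    using assms(2) generated_subset_closure_laurent by blast
  then obtain f where f: "\<And>n. \<exists>M. laurent M (f n)" "f \<longlonglongrightarrow> x"
    unfolding closure_sequential by blast
  have fY: "f n \<in> Y" for n using f(1) laurent_mem by blast
  have "(\<lambda>n. \<phi> (f n) - \<phi> x) \<longlonglongrightarrow> 0"
  proof (rule Lim_null_comparison)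
    show "\<forall>\<^sub>F n in sequentially. norm (\<phi> (f n) - \<phi> x) \<le> norm (f n - x)"
      using norm_hom_le[OF diff_mem[OF fY assms(1)]] by (simp add: hom_diff fY assms(1))
    show "(\<lambda>n. norm (f n - x)) \<longlonglongrightarrow> 0"
      using f(2) by (simp add: LIM_zero tendsto_norm_zero)
  qed
  then have "(\<lambda>n. \<phi> (f n)) \<longlonglongrightarrow> \<phi> x" by (rule LIM_zero_cancel)
  moreover have "norm (f n) \<le> norm (\<phi> (f n))" for n using f(1) norm_laurent_le by blast
  ultimately show ?thesis
    using f(2) by (intro LIMSEQ_le[of "\<lambda>n. norm (f n)" _ "\<lambda>n. norm (\<phi> (f n))"] tendsto_norm) auto
qed

theorem inj_on_generated:
  assumes "Y = cstar_generated (s ` \<Sigma> \<union> q ` \<B>)"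
  shows "inj_on \<phi> Y"
proof (rule inj_onI)
  fix x y assume xy: "x \<in> Y" "y \<in> Y" "\<phi> x = \<phi> y"
  then have "norm (x - y) \<le> norm (\<phi> (x - y))"
    using diff_mem[OF xy(1,2)] assms by (intro norm_generated_le) auto
  then show "x = y" using xy by (simp add: hom_diff)
qed

end

section \<open>Representations of quotient labelled spaces\<close>

lemma (in labelled_space) letter_word:
  assumes "a \<in> \<A>"
  shows "[a] \<in> labelled_words E lab"
proof -
  obtain e where e: "e \<in> arcs E" "lab e = a" using assms lab_surj by blast
  have "awalk (tail E e) [e] (head E e)" using e(1) by (rule arc_implies_awalk)
  then show ?thesis unfolding labelled_words_def using e(2)
    by (intro CollectI exI[of _ "[e]"] exI[of _ "tail E e"] exI[of _ "head E e"]) simp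
qed

lemma (in labelled_space) first_letter_out:
  assumes "rel_range E lab A \<alpha> \<noteq> {}"
  obtains a \<beta> where "\<alpha> = a # \<beta>" "a \<in> out_labels E lab A"
proof -
  obtain u \<mu> v where *: "u \<in> A" "\<mu> \<noteq> []" "awalk u \<mu> v" "map lab \<mu> = \<alpha>"
    using assms unfolding rel_range_def by blast
  then obtain e es where "\<mu> = e # es" by (cases \<mu>) auto
  then show ?thesis using * that by (auto simp: awalk_Cons_iff out_labels_def)
qed

text \<open>
  The summation relation for \<open>p\<^bsub>[A]\<^esub>\<close> presupposes that \<open>[A]\<close> emits a letter of the quotient alphabet. For
  \<open>[A] \<noteq> [\<emptyset>]\<close> this is automatic: some word over that alphabet has nontrivial relative range, and
  its first letter is emitted by \<open>A\<close> itself.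
\<close>

lemma (in labelled_space) quot_out_labels_nonempty:
  assumes qls: "quotient_labelled_space E lab \<A> \<B> R" and A: "A \<in> \<B>" "R `` {A} \<noteq> R `` {{}}"
  shows "quot_out_labels E lab R A \<inter> quot_alphabet E lab \<A> R \<noteq> {}"
proof -
  have "equiv \<B> R" using qls by (simp add: quotient_labelled_space_def)
  then have AR: "A \<in> R `` {A}" using A(1) by (rule equiv_class_self)
  obtain \<alpha> where \<alpha>: "\<alpha> \<in> quot_words E lab \<A> R" "R `` {rel_range E lab A \<alpha>} \<noteq> R `` {{}}"
    using qls A unfolding quotient_labelled_space_def by blast
  then have "rel_range E lab A \<alpha> \<noteq> {}" by auto
  then obtain a \<beta> where "\<alpha> = a # \<beta>" "a \<in> out_labels E lab A" by (rule first_letter_out)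
  then show ?thesis using \<alpha>(1) AR by (auto simp: quot_words_def quot_out_labels_def)
qed

lemma representation_imp_cuntz_krieger_family:
  assumes ls: "labelled_space E lab \<A> \<B>" and sf: "set_finite E lab \<B>"
    and rc: "closed_under_rel_complements \<B>"
    and qls: "quotient_labelled_space E lab \<A> \<B> R"
    and rep: "quot_representation E lab \<A> \<B> R (alg_on UNIV) s p"
  shows "cuntz_krieger_family \<B> (quot_alphabet E lab \<A> R) (\<lambda>a. word_range E lab [a])
    (\<lambda>a A. rel_range E lab A [a]) s (\<lambda>A. p (R `` {A}))"
proof -
  interpret labelled_space E lab \<A> \<B> by (rule ls)
  let ?\<Sigma> = "quot_alphabet E lab \<A> R"
  have word: "[a] \<in> labelled_words E lab" if "a \<in> ?\<Sigma>" for a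
    using that by (auto simp: quot_alphabet_def intro: letter_word)
  have diff: "A - B \<in> \<B>" if "A \<in> \<B>" "B \<in> \<B>" for A B
    using that rc by (simp add: closed_under_rel_complements_def)
  have cls: "R `` {A} \<in> \<B> // R" if "A \<in> \<B>" for A using that by (rule quotientI)
  have proj: "adj (p (R `` {A})) = p (R `` {A})" if "A \<in> \<B>" for A
    using rep cls[OF that] unfolding quot_representation_def alg_projection_def by (auto simp: alg_on_def)
  have iso: "s a * adj (s a) * s a = s a" if "a \<in> ?\<Sigma>" for a
    using rep that unfolding quot_representation_def alg_partial_isometry_def by (auto simp: alg_on_def)
  have zero: "p (R `` {{}}) = 0"
    and inter: "\<And>A B. A \<in> \<B> \<Longrightarrow> B \<in> \<B> \<Longrightarrow> p (R `` {A}) * p (R `` {B}) = p (R `` {A \<inter> B})"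
    and union: "\<And>A B. A \<in> \<B> \<Longrightarrow> B \<in> \<B> \<Longrightarrow>
      p (R `` {A \<union> B}) = p (R `` {A}) + p (R `` {B}) - p (R `` {A \<inter> B})"
    and move: "\<And>A a. A \<in> \<B> \<Longrightarrow> a \<in> ?\<Sigma> \<Longrightarrow> p (R `` {A}) * s a = s a * p (R `` {rel_range E lab A [a]})"
    and source: "\<And>a. a \<in> ?\<Sigma> \<Longrightarrow> adj (s a) * s a = p (R `` {word_range E lab [a]})"
    and orth: "\<And>a b. a \<in> ?\<Sigma> \<Longrightarrow> b \<in> ?\<Sigma> \<Longrightarrow> a \<noteq> b \<Longrightarrow> adj (s a) * s b = 0"
    using rep unfolding quot_representation_def by (auto simp: alg_on_def scaleC_minus_one)
  have expand: "\<exists>W. finite W \<and> W \<subseteq> ?\<Sigma> \<and>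
      p (R `` {A}) = (\<Sum>a\<in>W. s a * p (R `` {rel_range E lab A [a]}) * adj (s a))" if A: "A \<in> \<B>" for A
  proof (cases "R `` {A} = R `` {{}}")
    case True
    \<comment> \<open>for the trivial class both sides are zero, with the empty sum on the right\<close>
    then show ?thesis by (intro exI[of _ "{}"]) (simp add: zero)
  next
    case False
    define F where "F = {a \<in> quot_out_labels E lab R A \<inter> ?\<Sigma>. R `` {rel_range E lab A [a]} \<noteq> R `` {{}}}"
    \<comment> \<open>although \<open>F\<close> ranges over all representatives of the class, its letters are emitted by \<open>A\<close>, which is why it is finite\<close>
    have "F \<subseteq> out_labels E lab A"
    proof
      fix a assume "a \<in> F"
      then have "rel_range E lab A [a] \<noteq> {}" by (auto simp: F_def)
      then show "a \<in> out_labels E lab A" by (rule first_letter_out) auto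
    qed
    moreover have "finite (out_labels E lab A)" using sf A by (simp add: set_finite_def)
    ultimately have "finite F" by (rule finite_subset)
    moreover have "p (R `` {A}) = (\<Sum>a\<in>F. s a * p (R `` {rel_range E lab A [a]}) * adj (s a))"
      using rep A quot_out_labels_nonempty[OF qls A False]
      unfolding quot_representation_def Let_def alg_sum_alg_on F_def by (simp add: alg_on_def)
    moreover have "F \<subseteq> ?\<Sigma>" by (auto simp: F_def)
    ultimately show ?thesis by blast
  qed
  have split: "p (R `` {B}) = p (R `` {B \<inter> A}) + p (R `` {B - A})" if "A \<in> \<B>" "B \<in> \<B>" for A B
  proof -
    have "(B \<inter> A) \<union> (B - A) = B" "(B \<inter> A) \<inter> (B - A) = {}" by auto
    then show ?thesis
      using union[of "B \<inter> A" "B - A"] that by (simp add: inter_mem diff zero)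
  qed
  show ?thesis
    by unfold_locales
       (use word in \<open>auto simp: inter move source orth iso proj
          intro: inter_mem union_mem diff word_range_mem rel_range_mem split expand\<close>)
qed

lemma closed_star_subalgebra_cstar_generated: "closed_star_subalgebra (cstar_generated X)"
  unfolding cstar_generated_def closed_star_subalgebra_def by (auto intro!: closed_Inter)

lemma subset_cstar_generated: "X \<subseteq> cstar_generated X"
  unfolding cstar_generated_def by blast

theorem theorem4p2:
  fixes E :: "('v, 'e) pre_digraph"
    and lab :: "'e \<Rightarrow> 'l"
    and \<A> :: "'l set"
    and \<B> :: "'v set set"
    and R :: "('v set \<times> 'v set) set"
    and s :: "'l \<Rightarrow> 'u::cstar_algebra"
    and p :: "'v set set \<Rightarrow> 'u"
    and \<gamma> :: "complex \<Rightarrow> 'u \<Rightarrow> 'u"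
    and S :: "'l \<Rightarrow> 'b::cstar_algebra"
    and P :: "'v set set \<Rightarrow> 'b"
    and \<pi> :: "'u \<Rightarrow> 'b"
  assumes "labelled_space E lab \<A> \<B>"
    and "set_finite E lab \<B>"
    and "receiver_set_finite E lab \<B>"
    and "weakly_left_resolving E lab \<B>"
    and "no_sinks E"
    and "closed_under_rel_complements \<B>"
    and "quotient_labelled_space E lab \<A> \<B> R"
    and "quot_weakly_left_resolving E lab \<A> \<B> R"
    and "universal_representation E lab \<A> \<B> R s p"
    and "gauge_action E lab \<A> \<B> R s p \<gamma>"
    and "quot_representation E lab \<A> \<B> R (alg_on UNIV) S P"
    and "\<And>A. A \<in> \<B> \<Longrightarrow> R `` {A} \<noteq> R `` {{}} \<Longrightarrow> P (R `` {A}) \<noteq> 0"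
    and "\<And>a. a \<in> \<A> \<Longrightarrow> R `` {word_range E lab [a]} \<noteq> R `` {{}} \<Longrightarrow> S a \<noteq> 0"
    and "star_hom (alg_on (rep_cstar E lab \<A> \<B> R s p)) (alg_on (rep_cstar E lab \<A> \<B> R S P)) \<pi>"
    and "\<And>a. a \<in> quot_alphabet E lab \<A> R \<Longrightarrow> \<pi> (s a) = S a"
    and "\<And>X. X \<in> \<B> // R \<Longrightarrow> \<pi> (p X) = P X"
    and "\<exists>\<beta>. circle_action (rep_cstar E lab \<A> \<B> R S P) \<beta> \<and>
             strongly_continuous_on (rep_cstar E lab \<A> \<B> R S P) \<beta> \<and>
             (\<forall>z\<in>sphere 0 1. \<forall>x\<in>rep_cstar E lab \<A> \<B> R s p. \<beta> z (\<pi> x) = \<pi> (\<gamma> z x))"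
  shows "inj_on \<pi> (rep_cstar E lab \<A> \<B> R s p)"
proof -
  note hom = assms(14) and faithful = assms(12)
  let ?\<Sigma> = "quot_alphabet E lab \<A> R"
  let ?q = "\<lambda>A. p (R `` {A})"
  define Y where "Y = rep_cstar E lab \<A> \<B> R s p"
  define Z where "Z = rep_cstar E lab \<A> \<B> R S P"
  obtain \<beta> where \<beta>: "circle_action Z \<beta>"
    "\<And>z x. z \<in> sphere 0 1 \<Longrightarrow> x \<in> Y \<Longrightarrow> \<beta> z (\<pi> x) = \<pi> (\<gamma> z x)"
    using assms(17) unfolding Y_def Z_def by blast
  have rep: "quot_representation E lab \<A> \<B> R (alg_on UNIV) s p"
    using assms(9) by (simp add: universal_representation_def)
  have "p ` (\<B> // R) = ?q ` \<B>" by (auto simp: quotient_def)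
  then have Y_gen: "Y = cstar_generated (s ` ?\<Sigma> \<union> ?q ` \<B>)"
    by (simp add: Y_def rep_cstar_def)
  then have s_mem: "s a \<in> Y" if "a \<in> ?\<Sigma>" for a
    using that subset_cstar_generated[of "s ` ?\<Sigma> \<union> ?q ` \<B>"] by auto
  from Y_gen have q_mem: "?q A \<in> Y" if "A \<in> \<B>" for A
    using that subset_cstar_generated[of "s ` ?\<Sigma> \<union> ?q ` \<B>"] by auto
  have cls: "R `` {A} \<in> \<B> // R" if "A \<in> \<B>" for A using that by (rule quotientI)
  interpret star_hom_between Y Z \<pi>
    using hom closed_star_subalgebra_cstar_generated
    by unfold_locales (simp_all add: Y_def Z_def rep_cstar_def)
  have \<gamma>_s: "\<gamma> z (s a) = z *\<^sub>C s a" if "cmod z = 1" "a \<in> ?\<Sigma>" for z a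
    using assms(10) that unfolding gauge_action_def by simp
  have \<gamma>_q: "\<gamma> z (?q A) = ?q A" if "cmod z = 1" "A \<in> \<B>" for z A
    using assms(10) that cls unfolding gauge_action_def by simp
  have zero: "?q {} = 0"
    using rep by (simp add: quot_representation_def alg_on_def)
  have q_zeroD: "?q A = 0" if "A \<in> \<B>" "\<pi> (?q A) = 0" for A
    using faithful[OF that(1)] that(2) assms(16)[OF cls[OF that(1)]] zero
    by (cases "R `` {A} = R `` {{}}") auto
  interpret cuntz_krieger_family \<B> ?\<Sigma> "\<lambda>a. word_range E lab [a]" "\<lambda>a A. rel_range E lab A [a]" s ?q
    using assms(1,2,6,7) rep by (rule representation_imp_cuntz_krieger_family)
  interpret gauge_equivariant \<B> ?\<Sigma> "\<lambda>a. word_range E lab [a]" "\<lambda>a A. rel_range E lab A [a]"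
    s ?q Y Z \<pi> \<beta>
  proof unfold_locales
    show "closed_star_subalgebra Z"
      by (simp add: Z_def rep_cstar_def closed_star_subalgebra_cstar_generated)
  next
    fix z :: complex assume z: "cmod z = 1"
    then show "star_hom (alg_on Z) (alg_on Z) (\<beta> z)" using \<beta>(1) by (simp add: circle_action_def)
    show "\<beta> z (\<pi> (s a)) = z *\<^sub>C \<pi> (s a)" if "a \<in> ?\<Sigma>" for a
      using z that by (simp add: \<beta>(2) s_mem \<gamma>_s hom_scaleC)
    show "\<beta> z (\<pi> (?q A)) = \<pi> (?q A)" if "A \<in> \<B>" for A
      using z that by (simp add: \<beta>(2) q_mem \<gamma>_q)
  qed (auto simp: s_mem q_mem q_zeroD)
  show ?thesis using inj_on_generated[OF Y_gen] by (simp add: Y_def)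
qed

end
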